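(* For every positive integer $n$, $$\left\lfloor\frac{n}{p(\sqrt{n})}\right\rfloor\leqslant\kappa_{\leqslant 1}(n,n)\leqslant\sqrt{n-\frac{3}{4}}+\frac{1}{2},$$ and consequently $\displaystyle\lim_{n\to\infty}\frac{\kappa_{\leqslant 1}(n,n)}{\sqrt{n}}=1$.
   Context: For a real number $x$, $p(x)$ denotes the smallest prime not less than $x$. $[n]=\{1,\ldots,n\}$. $\kappa_{\leqslant 1}(n,m)$ is the maximum $k$ such that there exists a family of $m$ pairwise distinct $k$-element subsets of $[n]$ any two of which share at most one element. *)

theory Defs
  imports Complex_Main "HOL-Computational_Algebra.Primes"
begin

definition next_prime :: "real \<Rightarrow> nat" where
  "next_prime x = (LEAST p. prime p \<and> x \<le> real p)"

definition one_intersecting_family :: "nat \<Rightarrow> nat \<Rightarrow> nat \<Rightarrow> nat set set \<Rightarrow> bool" where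
  "one_intersecting_family n m k F \<longleftrightarrow>
     card F = m \<and>
     (\<forall>A\<in>F. A \<subseteq> {1..n} \<and> card A = k) \<and>
     (\<forall>A\<in>F. \<forall>B\<in>F. A \<noteq> B \<longrightarrow> card (A \<inter> B) \<le> 1)"

(* For 1 \<le> m the set of admissible k is bounded by n, and for 1 \<le> m \<le> n it contains 1, so
   that the maximum exists.  The values for m = 0 (all k admissible) and for m so large that
   no k is admissible carry no meaning. *)
definition kappa_le1 :: "nat \<Rightarrow> nat \<Rightarrow> nat" where
  "kappa_le1 n m = Max {k. \<exists>F. one_intersecting_family n m k F}"

end

theory Submission
  imports Defs "HOL-Complex_Analysis.Complex_Analysis" "HOL-Number_Theory.Prime_Powers"
    "HOL-Real_Asymp.Real_Asymp"
begin

text \<open>The upper bound counts the pairs of points covered by the sets. For the lower bound, take a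
  prime \<open>q \<ge> \<surd>n\<close>: two distinct non-vertical lines of the affine plane over \<open>\<int>/q\<close> meet in at most
  one point, and the restrictions of \<open>n\<close> of the \<open>q\<^sup>2\<close> such lines to \<open>\<lfloor>n/q\<rfloor>\<close> columns live on at most
  \<open>n\<close> points.

  The limit needs primes in \<open>[y, c y]\<close> for every \<open>c > 1\<close> and large \<open>y\<close>. This follows in
  the manner of Wiener and Ikehara: since \<open>\<zeta>\<close> has no zeros on \<open>Re s = 1\<close>, the Dirichlet series of
  \<open>\<Lambda>(n) - 1\<close> extends holomorphically across that line, so by an integration by parts the
  averages of \<open>\<Lambda>(n) n\<^sup>-\<^sup>\<sigma>\<close> and of \<open>n\<^sup>-\<^sup>\<sigma>\<close> against a Fejer kernel in \<open>ln n\<close> centred at \<open>x\<close>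
  differ by \<open>O(1/x)\<close>, uniformly in \<open>1 < \<sigma> \<le> 2\<close>. With \<open>\<sigma> = 1 + 1/x\<close> no limit \<open>\<sigma> \<rightarrow> 1\<close> has to be
  taken. A sufficiently narrow kernel then shows that prime powers occur within any fixed
  distance \<open>\<epsilon>\<close> of \<open>x\<close> on the logarithmic scale, and proper prime powers are too sparse to
  account for their contribution.\<close>

section \<open>The zeta function to the right of the imaginary axis\<close>

lemma norm_nat_powr: "cmod (of_nat n powr s) = real n powr Re s"
  using norm_powr_real_powr[of "of_nat n" s] by simp

lemma has_field_derivative_nat_powr:
  "((\<lambda>s. of_nat n powr (- s) :: complex) has_field_derivative - of_real (ln (real n)) * of_nat n powr (- s)) (at s)"
proof (cases "n = 0")
  case False
  then have "(\<lambda>s. of_nat n powr (- s) :: complex) = (\<lambda>s. exp (- s * of_real (ln (real n))))"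
    by (simp add: powr_def)
  moreover have "((\<lambda>s. exp (- s * of_real (ln (real n)))) has_field_derivative
      - of_real (ln (real n)) * exp (- s * of_real (ln (real n)))) (at s)"
    by (auto intro!: derivative_eq_intros)
  ultimately show ?thesis by metis
qed auto

text \<open>For n \<ge> 1 this is \<open>s - 1\<close> times the difference between
  \<open>n powr (-s)\<close> and the integral of \<open>t powr (-s)\<close> over
  \<open>[n, n+1]\<close>, freed of the denominator. The last two summands telescope over n. At n =
  0 the convention \<open>0 powr _ = 0\<close> leaves the constant 1, which accounts for the pole of
  zeta.\<close>

definition zterm :: "nat \<Rightarrow> complex \<Rightarrow> complex" where
  "zterm n s = (s - 1) * of_nat n powr (- s) - of_nat n * of_nat n powr (- s)
      + of_nat (Suc n) * of_nat (Suc n) powr (- s)"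

definition zreg :: "complex \<Rightarrow> complex" where
  "zreg s = (\<Sum>n. zterm n s)"

text \<open>\<open>zterm n s\<close> is the remainder of the first-order Taylor expansion of
  \<open>z powr (1 - s)\<close> at n with step 1, so it is governed by the second derivative on
  \<open>[n, n+1]\<close>. This gains a factor 1/n over the terms of zeta and gives convergence for
  Re s > 0.\<close>

lemma norm_zterm_le:
  assumes "Re s > 0" "n \<ge> 1"
  shows "cmod (zterm n s) \<le> cmod (s - 1) * cmod s * real n powr (- Re s - 1)"
proof -
  define f :: "nat \<Rightarrow> complex \<Rightarrow> complex" where
    "f i z = (if i = 0 then z powr (1 - s) else if i = 1 then (1 - s) * z powr (- s)
        else (1 - s) * (- s) * z powr (- s - 1))" for i z
  define S where "S = closed_segment (of_nat n :: complex) (of_nat (Suc n))"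
  have S: "\<exists>t. z = of_real t \<and> real n \<le> t" if zS: "z \<in> S" for z
  proof -
    obtain u where u: "0 \<le> u" "z = (1 - u) *\<^sub>R of_nat n + u *\<^sub>R of_nat (Suc n)"
      using zS unfolding S_def closed_segment_def by auto
    have "z = of_real (real n + u)"
      using u by (simp add: scaleR_conv_of_real algebra_simps)
    then show ?thesis using u by (intro exI[of _ "real n + u"]) auto
  qed
  have d: "(f i has_field_derivative f (Suc i) z) (at z within S)" if z: "z \<in> S" "i \<le> 1" for i z
  proof -
    obtain t where t: "z = of_real t" "real n \<le> t" using S z by blast
    then have "z \<notin> \<real>\<^sub>\<le>\<^sub>0" "z \<noteq> 0" using assms by auto
    have "i = 0 \<or> i = 1" using z by linarith
    then show ?thesis
    proof
      assume "i = 0"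
      then have *: "f i = (\<lambda>z. z powr (1 - s))" "f (Suc i) z = (1 - s) * z powr (1 - s - 1)"
        by (auto simp: f_def)
      show ?thesis unfolding * using \<open>z \<notin> \<real>\<^sub>\<le>\<^sub>0\<close>
        by (intro has_field_derivative_powr DERIV_subset[OF _ subset_UNIV])
    next
      assume "i = 1"
      then have *: "f i = (\<lambda>z. (1 - s) * z powr (- s))" "f (Suc i) z = (1 - s) * ((- s) * z powr (- s - 1))"
        by (auto simp: f_def)
      show ?thesis unfolding * using \<open>z \<notin> \<real>\<^sub>\<le>\<^sub>0\<close>
        by (intro DERIV_cmult has_field_derivative_powr DERIV_subset[OF _ subset_UNIV])
    qed
  qed
  have B: "norm (f (Suc 1) z) \<le> cmod (s - 1) * cmod s * real n powr (- Re s - 1)" if z: "z \<in> S" for z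
  proof -
    obtain t where t: "z = of_real t" "real n \<le> t" using S z by blast
    then have "cmod (z powr (- s - 1)) = t powr (- Re s - 1)"
      by (simp add: norm_powr_real_powr)
    also have "\<dots> \<le> real n powr (- Re s - 1)"
      using t assms by (intro powr_mono2') auto
    finally show ?thesis
      by (auto simp: f_def norm_mult norm_minus_commute intro!: mult_left_mono)
  qed
  have "convex S" "of_nat n \<in> S" "of_nat (Suc n) \<in> S" by (simp_all add: S_def)
  note field_Taylor[OF this(1) d B this(2,3)]
  moreover have "zterm n s = f 0 (of_nat (Suc n)) - (\<Sum>i\<le>1. f i (of_nat n) * (of_nat (Suc n) - of_nat n) ^ i / (fact i))"
  proof -
    have *: "z powr (1 - s) = z * z powr (- s)" if "z \<noteq> 0" for z :: complex
      using that by (simp add: powr_diff powr_minus field_simps)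
    have "(of_nat (Suc n) :: complex) \<noteq> 0" "of_nat n \<noteq> (0::complex)"
      using assms by (auto simp del: of_nat_Suc)
    note ** = this[THEN *]
    have "{..1} = {0, Suc 0}" by auto
    then show ?thesis
      using ** by (simp add: f_def zterm_def algebra_simps)
  qed
  ultimately show ?thesis by simp
qed

lemma zreg_aux:
  obtains g where "\<And>s. Re s > 0 \<Longrightarrow> (\<lambda>n. zterm n s) sums g s"
    "\<And>s. Re s > 0 \<Longrightarrow> g field_differentiable (at s)"
proof -
  have bnd: "\<exists>d h. 0 < d \<and> summable h \<and> range h \<subseteq> \<real>\<^sub>\<ge>\<^sub>0 \<and>
      (\<forall>\<^sub>F n in sequentially. \<forall>y\<in>ball s d \<inter> {s. 0 < Re s}. cmod (zterm n y) \<le> cmod (h n))"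
    if "s \<in> {s. Re s > 0}" for s
  proof -
    \<comment> \<open>The ball of this radius around s stays in Re y > d, so a single convergent
      majorant with exponent -d - 1 serves all its points.\<close>
    define d where "d = Re s / 2"
    define M where "M = cmod s + d + 1"
    have "d > 0" using that by (simp add: d_def)
    have bd: "cmod (zterm n y) \<le> M * M * real n powr (- d - 1)" if "n \<ge> 1" "y \<in> ball s d" for n y
    proof -
      have dist: "cmod (y - s) < d" using that by (simp add: dist_norm norm_minus_commute)
      have "\<bar>Re (y - s)\<bar> < d" using dist abs_Re_le_cmod[of "y - s"] by linarith
      then have Re: "Re y > d" by (simp add: d_def field_simps abs_if split: if_splits)
      have "cmod y \<le> cmod s + d" using dist norm_triangle_sub[of y s] by linarith
      moreover have "cmod (y - 1) \<le> cmod y + 1" using norm_triangle_ineq4[of y 1] by simp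
      ultimately have M: "cmod y \<le> M" "cmod (y - 1) \<le> M" "0 \<le> M"
        using \<open>d > 0\<close> by (auto simp: M_def)
      have "cmod (zterm n y) \<le> cmod (y - 1) * cmod y * real n powr (- Re y - 1)"
        using Re \<open>d > 0\<close> that by (intro norm_zterm_le) auto
      also have "\<dots> \<le> M * M * real n powr (- d - 1)"
        using Re that M by (intro mult_mono powr_mono) auto
      finally show ?thesis .
    qed
    have "summable (\<lambda>n. M * M * real n powr (- d - 1))"
      using \<open>d > 0\<close> by (intro summable_mult) (simp add: summable_real_powr_iff)
    then have "summable (\<lambda>n. of_real (M * M * real n powr (- d - 1)) :: complex)"
      by (rule summable_of_real)
    moreover have "M \<ge> 0" using \<open>d > 0\<close> by (simp add: M_def)
    ultimately show ?thesis using \<open>d > 0\<close> bd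
      by (intro exI[of _ d] exI[of _ "\<lambda>n. of_real (M * M * real n powr (- d - 1))"])
         (auto simp: norm_mult eventually_at_top_linorder intro!: exI[of _ 1] mult_nonneg_nonneg)
  qed
  have op: "open {s. 0 < Re s}" by (simp add: open_halfspace_Re_gt)
  have fd: "zterm n field_differentiable (at s)" for n s
  proof -
    have "(\<lambda>s. of_nat n powr (- s) :: complex) field_differentiable (at s)" for n
      using has_field_derivative_nat_powr field_differentiable_def by blast
    then show ?thesis unfolding zterm_def[abs_def]
      by (intro field_differentiable_add field_differentiable_diff field_differentiable_mult
          field_differentiable_const field_differentiable_ident)
  qed
  obtain g where "\<forall>x\<in>{s. 0 < Re s}. (\<lambda>n. zterm n x) sums g x \<and> g field_differentiable at x"
    by (rule series_differentiable_comparison_complex[OF op fd bnd])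
  then show ?thesis using that by blast
qed

lemma zterm_sums:
  assumes "Re s > 0"
  shows "(\<lambda>n. zterm n s) sums zreg s"
proof -
  obtain g where "\<And>s. Re s > 0 \<Longrightarrow> (\<lambda>n. zterm n s) sums g s" using zreg_aux by metis
  from this[OF assms] show ?thesis unfolding zreg_def by (rule summable_sums[OF sums_summable])
qed

lemma holomorphic_zreg: "zreg holomorphic_on {s. Re s > 0}"
proof -
  obtain g where g: "\<And>s. Re s > 0 \<Longrightarrow> (\<lambda>n. zterm n s) sums g s"
    "\<And>s. Re s > 0 \<Longrightarrow> g field_differentiable (at s)" using zreg_aux by blast
  then have "g holomorphic_on {s. Re s > 0}"
    by (auto simp: holomorphic_on_def intro: field_differentiable_at_within)
  then show ?thesis
    by (rule holomorphic_transform) (use sums_unique2[OF g(1) zterm_sums] in auto)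
qed

lemma zreg_1: "zreg 1 = 1"
proof -
  \<comment> \<open>At s = 1 everything cancels except the constant at n = 0; the value 1 is the
    residue of zeta at its pole.\<close>
  have "zterm n 1 = (if n = 0 then 1 else 0)" for n
    by (auto simp: zterm_def powr_minus field_simps simp del: of_nat_Suc)
  then have "(\<lambda>n. zterm n 1) sums 1" using sums_single[of 0 "\<lambda>_. 1::complex"] by simp
  then show ?thesis using zterm_sums[of 1] by (auto dest: sums_unique2)
qed

section \<open>The Dirichlet series of zeta and its derivative\<close>

definition zsum :: "complex \<Rightarrow> complex" where
  "zsum s = (\<Sum>n. of_nat n powr (- s))"

lemma summable_norm_nat_powr:
  "Re s > 1 \<Longrightarrow> summable (\<lambda>n. cmod (of_nat n powr (- s)))"
  by (simp add: norm_nat_powr summable_real_powr_iff)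

lemma zsum_sums: "Re s > 1 \<Longrightarrow> (\<lambda>n. of_nat n powr (- s)) sums zsum s"
  unfolding zsum_def by (rule summable_sums[OF summable_norm_cancel[OF summable_norm_nat_powr]])

text \<open>The partial sums of \<open>zterm\<close> telescope to \<open>s - 1\<close> times those
  of zeta plus the boundary term \<open>N powr (1 - s)\<close>, which vanishes in the limit. Hence
  \<open>zreg\<close> continues (s - 1) zeta(s) to Re s > 0.\<close>

lemma zreg_eq: 
  assumes "Re s > 1"
  shows "zreg s = (s - 1) * zsum s"
proof -
  have part: "(\<Sum>n<N. zterm n s) = (s - 1) * (\<Sum>n<N. of_nat n powr (- s)) + of_nat N * of_nat N powr (- s)" for N
    by (induction N) (simp_all add: zterm_def algebra_simps)
  have "(\<lambda>N. real N powr (1 - Re s)) \<longlonglongrightarrow> 0"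
    by (rule tendsto_neg_powr) (use assms filterlim_real_sequentially in auto)
  moreover have "cmod (of_nat N * of_nat N powr (- s)) = real N powr (1 - Re s)" for N
    unfolding norm_mult norm_nat_powr by (cases "N = 0") (simp_all add: powr_diff powr_minus field_simps)
  ultimately have "(\<lambda>N. of_nat N * of_nat N powr (- s)) \<longlonglongrightarrow> 0"
    by (subst tendsto_norm_zero_iff [symmetric]) simp
  then have "(\<lambda>N. (s - 1) * (\<Sum>n<N. of_nat n powr (- s)) + of_nat N * of_nat N powr (- s)) \<longlonglongrightarrow> (s - 1) * zsum s + 0"
    using zsum_sums[OF assms] unfolding sums_def by (intro tendsto_intros)
  then have "(\<lambda>n. zterm n s) sums ((s - 1) * zsum s)"
    by (simp add: sums_def part)
  then show ?thesis using zterm_sums[of s] assms by (auto dest: sums_unique2)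
qed

lemma log_summable:
  assumes "\<sigma> > (1::real)"
  shows "summable (\<lambda>n. ln (real n) * real n powr (- \<sigma>))"
proof -
  \<comment> \<open>Half of the excess of \<sigma> over 1 is spent on absorbing the logarithm; the
    other half keeps the series convergent.\<close>
  define a where "a = (\<sigma> - 1) / 2"
  have a: "a > 0" using assms by (simp add: a_def)
  have "norm (ln (real n) * real n powr (- \<sigma>)) \<le> (1 / a) * real n powr (- 1 - a)" for n
  proof (cases "n = 0")
    case False
    then have "ln (real n) * real n powr (- \<sigma>) \<le> (real n powr a / a) * real n powr (- \<sigma>)"
      using a by (intro mult_right_mono ln_powr_bound) auto
    also have "\<dots> = (1 / a) * real n powr (a + - \<sigma>)" unfolding powr_add by simp
    also have "a + - \<sigma> = - 1 - a" by (simp add: a_def field_simps)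
    finally show ?thesis using False by simp
  qed auto
  moreover have "summable (\<lambda>n. (1 / a) * real n powr (- 1 - a))"
    using a by (intro summable_mult) (simp add: summable_real_powr_iff)
  ultimately show ?thesis by (rule summable_comparison_test'[where N = 0, rotated])
qed

lemma zsum_deriv:
  assumes "Re s > 1"
  shows "(\<lambda>n. of_real (ln (real n)) * of_nat n powr (- s)) sums (- deriv zsum s)"
    "(zsum has_field_derivative deriv zsum s) (at s)"
proof -
  define S where "S = {s. Re s > 1}"
  have "open S" unfolding S_def by (simp add: open_halfspace_Re_gt)
  have "\<exists>d h. 0 < d \<and> summable h \<and> range h \<subseteq> \<real>\<^sub>\<ge>\<^sub>0 \<and>
      (\<forall>\<^sub>F n in sequentially. \<forall>y\<in>ball s d \<inter> S. cmod (of_nat n powr (- y)) \<le> cmod (h n))"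
    if "s \<in> S" for s
  proof -
    define d where "d = (Re s - 1) / 2"
    have "d > 0" using that by (simp add: d_def S_def)
    have bd: "real n powr (- Re y) \<le> real n powr (- 1 - d)" if "n \<ge> 1" "y \<in> ball s d" for n y
    proof -
      have "cmod (y - s) < d" using that by (simp add: dist_norm norm_minus_commute)
      then have "\<bar>Re (y - s)\<bar> < d" using abs_Re_le_cmod[of "y - s"] by linarith
      then have "Re y > 1 + d" by (simp add: d_def field_simps abs_if split: if_splits)
      then show ?thesis using that by (intro powr_mono) auto
    qed
    have "summable (\<lambda>n. of_real (real n powr (- 1 - d)) :: complex)"
      using \<open>d > 0\<close> by (intro summable_of_real) (simp add: summable_real_powr_iff)
    then show ?thesis using \<open>d > 0\<close> bd
      by (intro exI[of _ d] exI[of _ "\<lambda>n. of_real (real n powr (- 1 - d))"])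
         (auto simp: norm_nat_powr eventually_at_top_linorder intro!: exI[of _ 1])
  qed
  note bnd = this
  have fd: "((\<lambda>x. of_nat n powr (- x)) has_field_derivative - of_real (ln (real n)) * of_nat n powr (- x)) (at x)"
    for n and x :: complex by (rule has_field_derivative_nat_powr)
  have "\<exists>g g'. \<forall>x\<in>S. (\<lambda>n. of_nat n powr (- x)) sums g x \<and>
      (\<lambda>n. - of_real (ln (real n)) * of_nat n powr (- x)) sums g' x \<and> (g has_field_derivative g' x) (at x)"
    by (rule series_and_derivative_comparison_complex[OF \<open>open S\<close> fd bnd])
  then obtain g g' where g: "\<forall>x\<in>S. (\<lambda>n. of_nat n powr (- x)) sums g x \<and>
      (\<lambda>n. - of_real (ln (real n)) * of_nat n powr (- x)) sums g' x \<and> (g has_field_derivative g' x) (at x)"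
    by (elim exE)
  have "s \<in> S" using assms by (simp add: S_def)
  note gs = bspec[OF g this]
  have "(zsum has_field_derivative g' s) (at s)"
  proof (rule has_field_derivative_transform_within_open[OF _ \<open>open S\<close> \<open>s \<in> S\<close>])
    show "(g has_field_derivative g' s) (at s)" using gs by (elim conjE)
    show "g x = zsum x" if "x \<in> S" for x
      using that by (intro sums_unique2[OF conjunct1[OF bspec[OF g that]] zsum_sums]) (simp add: S_def)
  qed
  moreover from this have "deriv zsum s = g' s" by (rule DERIV_imp_deriv)
  ultimately show "(zsum has_field_derivative deriv zsum s) (at s)" by simp
  have "(\<lambda>n. - (- of_real (ln (real n)) * of_nat n powr (- s))) sums (- g' s)"
    by (rule sums_minus) (use gs in \<open>elim conjE\<close>)
  then show "(\<lambda>n. of_real (ln (real n)) * of_nat n powr (- s)) sums (- deriv zsum s)"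
    using \<open>deriv zsum s = g' s\<close> by simp
qed

section \<open>Non-vanishing on the line \<open>Re s = 1\<close>\<close>

text \<open>The absolutely convergent double series is regrouped along the hyperbolas m n = k. Since
  f and g vanish at 0, only positive indices matter, where each k has finitely many
  divisors.\<close>

lemma dirichlet_product_sums:
  fixes f g :: "nat \<Rightarrow> complex"
  assumes f: "summable (\<lambda>n. cmod (f n))" "f 0 = 0"
    and g: "summable (\<lambda>n. cmod (g n))" "g 0 = 0"
  shows "(\<lambda>n. \<Sum>d | d dvd n. f d * g (n div d)) sums (suminf f * suminf g)"
proof -
  have hf: "(f has_sum suminf f) UNIV"
    using f by (intro norm_summable_imp_has_sum summable_sums summable_norm_cancel[OF f(1)])
  have hg: "(g has_sum suminf g) UNIV"
    using g by (intro norm_summable_imp_has_sum summable_sums summable_norm_cancel[OF g(1)])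
  have nf: "((\<lambda>n. cmod (f n)) has_sum (\<Sum>n. cmod (f n))) UNIV"
    using f by (intro norm_summable_imp_has_sum summable_sums) auto
  have ng: "((\<lambda>n. cmod (g n)) has_sum (\<Sum>n. cmod (g n))) UNIV"
    using g by (intro norm_summable_imp_has_sum summable_sums) auto
  define F where "F = (\<lambda>x. f (fst x) * g (snd x))"
  have "(\<lambda>x. cmod (F x)) summable_on (UNIV \<times> UNIV)"
  proof (rule summable_on_SigmaI)
    fix m :: nat
    show "((\<lambda>n. cmod (F (m, n))) has_sum (cmod (f m) * (\<Sum>n. cmod (g n)))) UNIV"
      unfolding F_def norm_mult fst_conv snd_conv by (rule has_sum_cmult_right[OF ng])
  next
    show "(\<lambda>m. cmod (f m) * (\<Sum>n. cmod (g n))) summable_on UNIV"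
      using has_sum_cmult_left[OF nf] by (rule has_sum_imp_summable)
  qed auto
  then have "F summable_on (UNIV \<times> UNIV)" by (rule abs_summable_summable)
  then have "(F has_sum (suminf f * suminf g)) (UNIV \<times> UNIV)"
  proof (rule has_sum_SigmaI[rotated 2])
    fix m :: nat
    show "((\<lambda>n. F (m, n)) has_sum (f m * suminf g)) UNIV"
      unfolding F_def fst_conv snd_conv by (rule has_sum_cmult_right[OF hg])
  next
    show "((\<lambda>m. f m * suminf g) has_sum (suminf f * suminf g)) UNIV"
      by (rule has_sum_cmult_left[OF hf])
  qed
  also have "(F has_sum (suminf f * suminf g)) (UNIV \<times> UNIV)
      \<longleftrightarrow> (F has_sum (suminf f * suminf g)) ({0<..} \<times> {0<..})"
    by (rule has_sum_cong_neutral) (auto simp: F_def f(2) g(2) intro!: Nat.gr0I)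
  also have "\<dots> \<longleftrightarrow> ((\<lambda>x. f (snd x) * g (fst x div snd x)) has_sum (suminf f * suminf g)) (Sigma {0<..} (\<lambda>k. {d. d dvd k}))"
    by (rule has_sum_reindex_bij_witness[of _ "\<lambda>(k, d). (d, k div d)" "\<lambda>(m, n). (m * n, m)"])
       (auto simp: F_def elim!: dvdE)
  finally have "((\<lambda>k. \<Sum>d | d dvd k. f d * g (k div d)) has_sum (suminf f * suminf g)) {0<..}"
    by (rule has_sum_SigmaD) (auto intro!: has_sum_finiteI)
  \<comment> \<open>The index 0 can be put back: all numbers divide 0, and a sum over an infinite
    set is 0 by convention.\<close>
  also have "?this \<longleftrightarrow> ((\<lambda>k. \<Sum>d | d dvd k. f d * g (k div d)) has_sum (suminf f * suminf g)) UNIV"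
    by (rule has_sum_cong_neutral) auto
  finally show ?thesis by (rule has_sum_imp_sums)
qed

section \<open>The von Mangoldt series and the logarithmic derivative\<close>

definition msum :: "complex \<Rightarrow> complex" where
  "msum s = (\<Sum>n. mangoldt n * of_nat n powr (- s))"

lemma summable_mangoldt_powr:
  assumes "\<sigma> > 1"
  shows "summable (\<lambda>n. mangoldt n * real n powr (- \<sigma>))"
proof (rule summable_comparison_test'[where N = 1, OF log_summable[OF assms]])
  fix n :: nat assume "n \<ge> 1"
  then show "norm (mangoldt n * real n powr (- \<sigma>)) \<le> ln (real n) * real n powr (- \<sigma>)"
    using mangoldt_le[of n] mangoldt_nonneg[of n] by (auto simp: abs_mult intro!: mult_right_mono)
qed

lemma summable_norm_mangoldt_powr:
  "Re s > 1 \<Longrightarrow> summable (\<lambda>n. cmod (mangoldt n * of_nat n powr (- s)))"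
  using summable_mangoldt_powr[of "Re s"] by (simp add: norm_mult norm_nat_powr)

lemma msum_sums: "Re s > 1 \<Longrightarrow> (\<lambda>n. mangoldt n * of_nat n powr (- s)) sums msum s"
  unfolding msum_def by (rule summable_sums[OF summable_norm_cancel[OF summable_norm_mangoldt_powr]])

text \<open>Compares coefficients: the Dirichlet convolution of \<Lambda> with 1 is ln. The product
  form avoids dividing by zeta before its zeros have been excluded.\<close>

lemma msum_mult_zsum:
  assumes "Re s > 1"
  shows "msum s * zsum s = - deriv zsum s"
proof -
  have "(\<lambda>n. \<Sum>d | d dvd n. (mangoldt d * of_nat d powr (- s)) * of_nat (n div d) powr (- s)) sums (msum s * zsum s)"
    unfolding msum_def zsum_def
    by (rule dirichlet_product_sums[OF summable_norm_mangoldt_powr[OF assms] _ summable_norm_nat_powr[OF assms]]) auto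
  also have "(\<lambda>n. \<Sum>d | d dvd n. (mangoldt d * of_nat d powr (- s)) * of_nat (n div d) powr (- s))
      = (\<lambda>n. of_real (ln (real n)) * of_nat n powr (- s))"
  proof
    fix n :: nat
    show "(\<Sum>d | d dvd n. (mangoldt d * of_nat d powr (- s)) * of_nat (n div d) powr (- s))
      = of_real (ln (real n)) * of_nat n powr (- s)"
    proof (cases "n = 0")
      case False
      have "(\<Sum>d | d dvd n. (mangoldt d * of_nat d powr (- s)) * of_nat (n div d) powr (- s))
          = (\<Sum>d | d dvd n. mangoldt d * of_nat n powr (- s))"
      proof (rule sum.cong, goal_cases)
        case (2 d)
        then obtain e where n: "n = d * e" by (auto elim: dvdE)
        with False have pos: "d > 0" "e > 0" by auto
        have "(of_nat d * of_nat e :: complex) powr (- s) = of_nat d powr (- s) * of_nat e powr (- s)"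
          using powr_times_real[of "of_nat d" "of_nat e" "- s"] by simp
        then show ?case using n pos by simp
      qed simp
      then show ?thesis using mangoldt_sum[OF False, where ?'a = complex]
        by (simp flip: sum_distrib_right)
    qed auto
  qed
  finally show ?thesis using zsum_deriv(1)[OF assms] by (rule sums_unique2)
qed

text \<open>Differentiates (s - 1) zeta(s). The factor \<open>zreg s\<close> stays on the right
  because this identity is itself used to show that \<open>zreg\<close> has no zeros for Re s >
  1.\<close>

lemma deriv_zreg:
  assumes "Re s > 1"
  shows "deriv zreg s = zreg s * (1 / (s - 1) - msum s)"
proof -
  have "((\<lambda>s. (s - 1) * zsum s) has_field_derivative (zsum s + (s - 1) * deriv zsum s)) (at s)"
    by (rule derivative_eq_intros zsum_deriv(2)[OF assms] refl)+ simp
  then have "(zreg has_field_derivative (zsum s + (s - 1) * deriv zsum s)) (at s)"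
    by (rule has_field_derivative_transform_within_open[OF _ open_halfspace_Re_gt[of 1]])
       (use assms zreg_eq in auto)
  then have "deriv zreg s = zsum s + (s - 1) * deriv zsum s" by (rule DERIV_imp_deriv)
  also have "deriv zsum s = - (msum s * zsum s)" using msum_mult_zsum[OF assms] by simp
  also have "zsum s + (s - 1) * - (msum s * zsum s) = zreg s * (1 / (s - 1) - msum s)"
  proof -
    have "(s - 1) * zsum s * (1 / (s - 1)) = zsum s" using assms by auto
    then show ?thesis by (simp only: zreg_eq[OF assms] right_diff_distrib) (simp add: mult_ac)
  qed
  finally show ?thesis .
qed

text \<open>Near a, f is g times the k-th power of z - a with g(a) \<noteq> 0, so f'/f has at most a
  simple pole there, with residue k. This turns the order of a zero into a limit that can be
  compared with Dirichlet series.\<close>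

lemma log_deriv_tendsto_order:
  assumes holo: "f holomorphic_on S" "open S" "connected S" "a \<in> S" "\<exists>w\<in>S. f w \<noteq> 0"
  shows "\<exists>k::nat. (k > 0 \<longleftrightarrow> f a = 0) \<and> ((\<lambda>z. (z - a) * (deriv f z / f z)) \<longlongrightarrow> of_nat k) (at a)"
proof -
  define k where "k = nat (zorder f a)"
  define g where "g = zor_poly f a"
  have *: "(if f a = 0 then zorder f a > 0 else zorder f a = 0)"
    and "\<exists>r. r>0 \<and> cball a r \<subseteq> S \<and> g holomorphic_on cball a r
      \<and> (\<forall>w\<in>cball a r. f w  = g w * (w-a) ^ k \<and> g w \<noteq>0)"
    using zorder_exist_zero[OF holo] by (auto simp: k_def g_def)
  then obtain r where r: "r > 0" "g holomorphic_on cball a r"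
    "\<And>w. w \<in> cball a r \<Longrightarrow> f w = g w * (w-a) ^ k" "\<And>w. w \<in> cball a r \<Longrightarrow> g w \<noteq> 0" by metis
  have holg: "g holomorphic_on ball a r" using r(2) by (rule holomorphic_on_subset) auto
  have eq: "(z - a) * (deriv f z / f z) = (z - a) * (deriv g z / g z) + of_nat k"
    if z: "z \<in> ball a r" "z \<noteq> a" for z
  proof -
    have "(g has_field_derivative deriv g z) (at z)"
      using holg z by (intro holomorphic_derivI[of _ "ball a r"]) auto
    then have "((\<lambda>w. g w * (w - a) ^ k) has_field_derivative
        (deriv g z * (z - a) ^ k + g z * (of_nat k * (z - a) ^ (k - 1)))) (at z)"
      by (auto intro!: derivative_eq_intros)
    then have "(f has_field_derivative
        (deriv g z * (z - a) ^ k + g z * (of_nat k * (z - a) ^ (k - 1)))) (at z)"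
      by (rule has_field_derivative_transform_within_open[OF _ open_ball[of a r]])
         (use z r(3) in auto)
    then have d: "deriv f z = deriv g z * (z - a) ^ k + g z * (of_nat k * (z - a) ^ (k - 1))"
      by (rule DERIV_imp_deriv)
    have "(z - a) * (of_nat k * (z - a) ^ (k - 1)) = of_nat k * (z - a) ^ k"
      by (cases k) auto
    moreover have "(z - a) * deriv f z = (z - a) * deriv g z * (z - a) ^ k
        + g z * ((z - a) * (of_nat k * (z - a) ^ (k - 1)))"
      unfolding d by (simp only: distrib_left mult_ac)
    ultimately have "(z - a) * deriv f z = (z - a) * deriv g z * (z - a) ^ k + g z * (of_nat k * (z - a) ^ k)"
      by (simp only:)
    note D = this
    have "f z = g z * (z - a) ^ k" "g z \<noteq> 0" "(z - a) ^ k \<noteq> 0" using r z by auto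
    moreover have "(z - a) * (deriv f z / f z) = ((z - a) * deriv f z) / f z" by simp
    ultimately show ?thesis unfolding D by (simp add: add_divide_distrib)
  qed
  have "continuous_on (ball a r) (deriv g)" "continuous_on (ball a r) g"
    by (intro holomorphic_on_imp_continuous_on holomorphic_deriv holg open_ball)+
  then have "isCont (deriv g) a" "isCont g a"
    using r(1) by (auto simp: continuous_on_eq_continuous_at)
  then have "isCont (\<lambda>z. (z - a) * (deriv g z / g z) + of_nat k) a"
    using r by (intro continuous_intros) auto
  then have "((\<lambda>z. (z - a) * (deriv g z / g z) + of_nat k) \<longlongrightarrow> of_nat k) (at a)"
    by (simp add: isCont_def)
  moreover have "eventually (\<lambda>z. (z - a) * (deriv g z / g z) + of_nat k = (z - a) * (deriv f z / f z)) (at a)"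
    using eventually_at_ball'[OF r(1), of a UNIV] by eventually_elim (rule eq[symmetric], auto)
  ultimately have "((\<lambda>z. (z - a) * (deriv f z / f z)) \<longlongrightarrow> of_nat k) (at a)"
    by (rule Lim_transform_eventually)
  moreover have "k > 0 \<longleftrightarrow> f a = 0" using * by (auto simp: k_def split: if_splits)
  ultimately show ?thesis by blast
qed

lemma zreg_log_deriv_order:
  assumes "Re a > 0"
  shows "\<exists>k::nat. (k > 0 \<longleftrightarrow> zreg a = 0) \<and>
    ((\<lambda>h. of_real h * (deriv zreg (a + of_real h) / zreg (a + of_real h))) \<longlongrightarrow> of_nat k) (at_right 0)"
proof -
  have "connected {s. Re s > 0}" by (intro convex_connected convex_halfspace_Re_gt)
  moreover have "\<exists>w\<in>{s. Re s > 0}. zreg w \<noteq> 0" using zreg_1 by (intro bexI[of _ 1]) auto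
  ultimately obtain k :: nat where k: "k > 0 \<longleftrightarrow> zreg a = 0"
      "((\<lambda>z. (z - a) * (deriv zreg z / zreg z)) \<longlongrightarrow> of_nat k) (at a)"
    using log_deriv_tendsto_order[OF holomorphic_zreg open_halfspace_Re_gt, of a] assms by auto
  have "filterlim (\<lambda>h. a + complex_of_real h) (at a) (at_right 0)"
    unfolding filterlim_at
    by (auto intro!: tendsto_eq_intros simp: eventually_at_filter)
  from filterlim_compose[OF k(2) this] k(1) show ?thesis by (intro exI[of _ k]) simp
qed

text \<open>A zero would give the logarithmic derivative a pole at a. To the right of a, however, it
  equals 1/(s - 1) minus the absolutely convergent \<open>msum\<close> and is bounded by M, so its
  residue is 0. No Euler product is involved.\<close>

lemma zreg_nonzero_gt:
  assumes "Re a > 1"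
  shows "zreg a \<noteq> 0"
proof
  assume "zreg a = 0"
  then obtain k :: nat where k: "k > 0"
    "((\<lambda>h. of_real h * (deriv zreg (a + of_real h) / zreg (a + of_real h))) \<longlongrightarrow> of_nat k) (at_right 0)"
    using zreg_log_deriv_order[of a] assms by auto
  define M where "M = 1 / (Re a - 1) + (\<Sum>n. mangoldt n * real n powr (- Re a))"
  have bd: "cmod (of_real h * (deriv zreg (a + of_real h) / zreg (a + of_real h))) \<le> h * M" if "h > 0" for h
  proof -
    let ?s = "a + of_real h"
    have s: "Re ?s > 1" using assms that by simp
    have "cmod (msum ?s) \<le> (\<Sum>n. cmod (mangoldt n * of_nat n powr (- ?s)))"
      unfolding msum_def by (rule summable_norm[OF summable_norm_mangoldt_powr[OF s]])
    also have "\<dots> \<le> (\<Sum>n. mangoldt n * real n powr (- Re a))"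
    proof (rule suminf_le[OF _ summable_norm_mangoldt_powr[OF s] summable_mangoldt_powr[OF assms]])
      show "cmod (mangoldt n * of_nat n powr (- ?s)) \<le> mangoldt n * real n powr (- Re a)" for n
        using that mangoldt_nonneg[of n] by (cases "n = 0")
          (auto simp: norm_mult norm_nat_powr intro!: mult_left_mono powr_mono)
    qed
    finally have "cmod (msum ?s) \<le> (\<Sum>n. mangoldt n * real n powr (- Re a))" .
    moreover have "cmod (1 / (?s - 1)) \<le> 1 / (Re a - 1)"
    proof -
      have "Re a - 1 \<le> Re (?s - 1)" using that by simp
      also have "\<dots> \<le> cmod (?s - 1)" by (rule complex_Re_le_cmod)
      finally show ?thesis unfolding norm_divide norm_one using assms by (intro frac_le) auto
    qed
    ultimately have "cmod (1 / (?s - 1) - msum ?s) \<le> M"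
      unfolding M_def using norm_triangle_ineq4[of "1 / (?s - 1)" "msum ?s"] by linarith
    \<comment> \<open>Where \<open>zreg\<close> vanishes, the quotient is 0 by the convention on
      division and the bound is trivial.\<close>
    moreover have "cmod (deriv zreg ?s / zreg ?s) \<le> cmod (1 / (?s - 1) - msum ?s)"
      unfolding deriv_zreg[OF s] by (cases "zreg ?s = 0") auto
    ultimately show ?thesis unfolding norm_mult using that by (auto intro!: mult_left_mono)
  qed
  have "((\<lambda>h. of_real h * (deriv zreg (a + of_real h) / zreg (a + of_real h))) \<longlongrightarrow> 0) (at_right 0)"
  proof (rule Lim_null_comparison)
    show "\<forall>\<^sub>F h in at_right 0. cmod (of_real h * (deriv zreg (a + of_real h) / zreg (a + of_real h))) \<le> h * M"
      using bd by (auto simp: eventually_at_filter)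
    show "((\<lambda>h. h * M) \<longlongrightarrow> 0) (at_right 0)" by (auto intro!: tendsto_eq_intros)
  qed
  from tendsto_unique[OF _ k(2) this] k(1) show False by simp
qed

lemma nat_powr_cis:
  assumes "n > 0"
  shows "of_nat n powr (- s) = of_real (real n powr (- Re s)) * cis (- (Im s * ln (real n)))"
proof -
  have "of_nat n powr (- s) = exp (- s * of_real (ln (real n)))"
    using assms by (simp add: powr_def)
  also have "\<dots> = of_real (exp (- Re s * ln (real n))) * cis (- (Im s * ln (real n)))"
    by (simp add: exp_eq_polar)
  also have "exp (- Re s * ln (real n)) = real n powr (- Re s)"
    using assms by (simp add: powr_def)
  finally show ?thesis .
qed

text \<open>Termwise, with \<theta> = t ln n, this is the classical inequality 3 + 4 cos \<theta> +
  cos 2\<theta> = 2 (1 + cos \<theta>)^2 \<ge> 0, weighted by the nonnegative \<Lambda>(n).\<close>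

lemma msum_3_4_1:
  assumes "h > 0"
  shows "3 * Re (msum (1 + of_real h)) + 4 * Re (msum (Complex 1 t + of_real h))
      + Re (msum (Complex 1 (2 * t) + of_real h)) \<ge> 0"
proof -
  let ?f = "\<lambda>t n. Re (mangoldt n * of_nat n powr (- (Complex 1 t + of_real h)))"
  have f: "?f t sums Re (msum (Complex 1 t + of_real h))" for t
    by (rule sums_Re[OF msum_sums]) (use assms in simp)
  have "(\<lambda>n. 3 * ?f 0 n + 4 * ?f t n + ?f (2 * t) n) sums
      (3 * Re (msum (Complex 1 0 + of_real h)) + 4 * Re (msum (Complex 1 t + of_real h))
      + Re (msum (Complex 1 (2 * t) + of_real h)))"
    by (intro sums_add sums_mult[OF f] f)
  moreover have "3 * ?f 0 n + 4 * ?f t n + ?f (2 * t) n \<ge> 0" for n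
  proof (cases "n = 0")
    case False
    define \<theta> where "\<theta> = t * ln (real n)"
    define c where "c = mangoldt n * real n powr (- (1 + h))"
    have *: "?f u n = c * cos (u * ln (real n))" for u
    proof -
      have m: "(mangoldt n :: complex) = of_real (mangoldt n)" by simp
      have "n > 0" using False by simp
      then show ?thesis unfolding m by (subst nat_powr_cis) (simp_all add: c_def)
    qed
    have "3 * ?f 0 n + 4 * ?f t n + ?f (2 * t) n = c * (3 + 4 * cos \<theta> + cos (2 * \<theta>))"
      unfolding * by (simp add: \<theta>_def algebra_simps)
    also have "3 + 4 * cos \<theta> + cos (2 * \<theta>) = 2 * (1 + cos \<theta>)\<^sup>2"
      using cos_double_cos[of \<theta>] by (simp add: power2_eq_square algebra_simps)
    also have "c * \<dots> \<ge> 0" using mangoldt_nonneg[of n] by (simp add: c_def)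
    finally show ?thesis .
  qed auto
  ultimately have "3 * Re (msum (Complex 1 0 + of_real h)) + 4 * Re (msum (Complex 1 t + of_real h))
      + Re (msum (Complex 1 (2 * t) + of_real h)) \<ge> 0" by (rule sums_le[OF _ sums_zero, rotated])
  moreover have "Complex 1 0 = 1" by (simp add: complex_eq_iff)
  ultimately show ?thesis by simp
qed

text \<open>Away from s = 1 the summand 1/(s - 1) of \<open>msum\<close> is bounded, so only the
  zero of \<open>zreg\<close> contributes: h times \<open>msum\<close> tends to minus its
  order.\<close>

lemma msum_tendsto:
  assumes "Re a = 1" "a \<noteq> 1"
  shows "\<exists>k::nat. (k > 0 \<longleftrightarrow> zreg a = 0) \<and>
    ((\<lambda>h. h * Re (msum (a + of_real h))) \<longlongrightarrow> - real k) (at_right 0)"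
proof -
  obtain k :: nat where k: "k > 0 \<longleftrightarrow> zreg a = 0"
    "((\<lambda>h. of_real h * (deriv zreg (a + of_real h) / zreg (a + of_real h))) \<longlongrightarrow> of_nat k) (at_right 0)"
    using zreg_log_deriv_order[of a] assms by auto
  have "((\<lambda>h. complex_of_real h / (a + of_real h - 1)) \<longlongrightarrow> 0) (at_right 0)"
    using assms by (auto intro!: tendsto_eq_intros)
  from tendsto_diff[OF this k(2)]
  have "((\<lambda>h. Re (complex_of_real h / (a + of_real h - 1) - of_real h * (deriv zreg (a + of_real h) / zreg (a + of_real h))))
      \<longlongrightarrow> Re (0 - of_nat k)) (at_right 0)" by (rule tendsto_Re)
  moreover have "\<forall>\<^sub>F h in at_right 0. Re (complex_of_real h / (a + of_real h - 1) - of_real h * (deriv zreg (a + of_real h) / zreg (a + of_real h)))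
     = h * Re (msum (a + of_real h))"
    unfolding eventually_at_filter
  proof (intro always_eventually allI impI)
    fix h :: real assume "h \<in> {0<..}"
    then have s: "Re (a + of_real h) > 1" using assms by simp
    have "deriv zreg (a + of_real h) / zreg (a + of_real h) = 1 / (a + of_real h - 1) - msum (a + of_real h)"
      using zreg_nonzero_gt[OF s] deriv_zreg[OF s] by simp
    then have "complex_of_real h / (a + of_real h - 1) - of_real h * (deriv zreg (a + of_real h) / zreg (a + of_real h))
        = of_real h * msum (a + of_real h)"
      by (simp only:) (simp add: right_diff_distrib)
    then show "Re (complex_of_real h / (a + of_real h - 1) - of_real h * (deriv zreg (a + of_real h) / zreg (a + of_real h)))
     = h * Re (msum (a + of_real h))" by simp
  qed
  ultimately have "((\<lambda>h. h * Re (msum (a + of_real h))) \<longlongrightarrow> Re (0 - of_nat k)) (at_right 0)"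
    by (rule Lim_transform_eventually)
  then show ?thesis using k(1) by (intro exI[of _ k]) simp
qed

text \<open>At s = 1 the order of \<open>zreg\<close> is 0, so the limit comes from the pole 1/(s -
  1) alone.\<close>

lemma msum_tendsto_1:
  "((\<lambda>h. h * Re (msum (1 + of_real h))) \<longlongrightarrow> 1) (at_right 0)"
proof -
  obtain k :: nat where k: "k > 0 \<longleftrightarrow> zreg 1 = 0"
    "((\<lambda>h. of_real h * (deriv zreg (1 + of_real h) / zreg (1 + of_real h))) \<longlongrightarrow> of_nat k) (at_right 0)"
    using zreg_log_deriv_order[of 1] by auto
  then have "k = 0" using zreg_1 by simp
  with tendsto_diff[OF tendsto_const k(2)]
  have "((\<lambda>h. Re (1 - of_real h * (deriv zreg (1 + of_real h) / zreg (1 + of_real h))))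
      \<longlongrightarrow> Re (1 - of_nat k)) (at_right 0)" by (intro tendsto_Re)
  moreover have "\<forall>\<^sub>F h in at_right 0. Re (1 - of_real h * (deriv zreg (1 + of_real h) / zreg (1 + of_real h)))
     = h * Re (msum (1 + of_real h))"
    unfolding eventually_at_filter
  proof (intro always_eventually allI impI)
    fix h :: real assume h: "h \<noteq> 0" "h \<in> {0<..}"
    then have s: "Re (1 + of_real h) > 1" by simp
    have "deriv zreg (1 + of_real h) / zreg (1 + of_real h) = 1 / of_real h - msum (1 + of_real h)"
      using zreg_nonzero_gt[OF s] deriv_zreg[OF s] by simp
    then have "1 - of_real h * (deriv zreg (1 + of_real h) / zreg (1 + of_real h))
        = of_real h * msum (1 + of_real h)"
      by (simp only:) (use h in \<open>simp add: right_diff_distrib\<close>)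
    then show "Re (1 - of_real h * (deriv zreg (1 + of_real h) / zreg (1 + of_real h)))
     = h * Re (msum (1 + of_real h))" by simp
  qed
  ultimately have "((\<lambda>h. h * Re (msum (1 + of_real h))) \<longlongrightarrow> Re (1 - of_nat k)) (at_right 0)"
    by (rule Lim_transform_eventually)
  then show ?thesis using \<open>k = 0\<close> by simp
qed

text \<open>Multiply the 3-4-1 inequality by h and let h tend to 0. A zero of order k at 1 + it and
  one of order l at 1 + 2it would give 3 - 4k - l \<ge> 0, which fails for k \<ge> 1.\<close>

lemma zreg_nonzero:
  assumes "Re s \<ge> 1"
  shows "zreg s \<noteq> 0"
proof
  assume z: "zreg s = 0"
  with assms zreg_nonzero_gt[of s] have "Re s = 1" by linarith
  define t where "t = Im s"
  have s: "s = Complex 1 t" by (simp add: complex_eq_iff t_def \<open>Re s = 1\<close>)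
  have "Complex 1 0 = 1" by (simp add: complex_eq_iff)
  then have "t \<noteq> 0" using z zreg_1 s by auto
  then have "s \<noteq> 1" "Complex 1 (2 * t) \<noteq> 1" by (auto simp: complex_eq_iff s)
  obtain k :: nat where k: "k > 0" "((\<lambda>h. h * Re (msum (Complex 1 t + of_real h))) \<longlongrightarrow> - real k) (at_right 0)"
    using msum_tendsto[of s] \<open>s \<noteq> 1\<close> z s by auto
  obtain l :: nat where l: "((\<lambda>h. h * Re (msum (Complex 1 (2 * t) + of_real h))) \<longlongrightarrow> - real l) (at_right 0)"
    using msum_tendsto[of "Complex 1 (2 * t)"] \<open>Complex 1 (2 * t) \<noteq> 1\<close> by auto
  have "0 \<le> 3 * 1 + 4 * (- real k) + (- real l)"
  proof (rule tendsto_lowerbound)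
    show "((\<lambda>h. 3 * (h * Re (msum (1 + of_real h))) + 4 * (h * Re (msum (Complex 1 t + of_real h)))
      + h * Re (msum (Complex 1 (2 * t) + of_real h))) \<longlongrightarrow> 3 * 1 + 4 * (- real k) + (- real l)) (at_right 0)"
      by (intro tendsto_intros msum_tendsto_1 k l)
    show "\<forall>\<^sub>F h in at_right 0. 0 \<le> 3 * (h * Re (msum (1 + of_real h))) + 4 * (h * Re (msum (Complex 1 t + of_real h)))
      + h * Re (msum (Complex 1 (2 * t) + of_real h))"
      unfolding eventually_at_filter
    proof (intro always_eventually allI impI)
      fix h :: real assume "h \<in> {0<..}"
      then have "0 \<le> h * (3 * Re (msum (1 + of_real h)) + 4 * Re (msum (Complex 1 t + of_real h))
          + Re (msum (Complex 1 (2 * t) + of_real h)))"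
        by (intro mult_nonneg_nonneg msum_3_4_1) auto
      then show "0 \<le> 3 * (h * Re (msum (1 + of_real h))) + 4 * (h * Re (msum (Complex 1 t + of_real h)))
      + h * Re (msum (Complex 1 (2 * t) + of_real h))" by (simp add: algebra_simps)
    qed
  qed auto
  then show False using k(1) by simp
qed

text \<open>The difference \<open>\<Sum> (\<Lambda>(n) - 1) n\<^sup>-\<^sup>s\<close> extends holomorphically to a neighbourhood of \<open>Re s \<ge> 1\<close>.\<close>

definition dsum :: "complex \<Rightarrow> complex" where
  "dsum s = - (deriv zreg s / zreg s) - (if s = 1 then deriv zreg 1 else (zreg s - zreg 1) / (s - 1))"

text \<open>The series of \<Lambda> and of 1 both have the polar part 1/(s - 1); it cancels in the
  difference and only regular terms remain.\<close>

lemma dsum_sums: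
  assumes "Re s > 1"
  shows "(\<lambda>n. (mangoldt n - 1) * of_nat n powr (- s)) sums dsum s"
proof -
  have "s \<noteq> 1" using assms by auto
  have "(\<lambda>n. mangoldt n * of_nat n powr (- s) - of_nat n powr (- s)) sums (msum s - zsum s)"
    by (intro sums_diff msum_sums zsum_sums assms)
  moreover have "msum s - zsum s = dsum s"
  proof -
    have "deriv zreg s / zreg s = 1 / (s - 1) - msum s"
      using zreg_nonzero_gt[OF assms] deriv_zreg[OF assms] by simp
    moreover have "(zreg s - 1) / (s - 1) = zsum s - 1 / (s - 1)"
      using \<open>s \<noteq> 1\<close> by (simp add: zreg_eq[OF assms] diff_divide_distrib)
    ultimately show ?thesis using \<open>s \<noteq> 1\<close> by (simp add: dsum_def zreg_1)
  qed
  ultimately show ?thesis by (simp add: algebra_simps)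
qed

text \<open>By \<open>zreg_nonzero\<close> this contains the closed half-plane Re s \<ge> 1. Being
  open as well, it lets \<open>dsum\<close> and its derivative be used on the boundary line
  itself.\<close>

definition zdom :: "complex set" where
  "zdom = {s. Re s > 0 \<and> zreg s \<noteq> 0}"

lemma open_zdom: "open zdom"
proof -
  have "open ({s. Re s > 0} \<inter> zreg -` (- {0}))"
    by (rule continuous_open_preimage[OF holomorphic_on_imp_continuous_on[OF holomorphic_zreg] open_halfspace_Re_gt]) auto
  also have "{s. Re s > 0} \<inter> zreg -` (- {0}) = zdom" by (auto simp: zdom_def)
  finally show ?thesis .
qed

text \<open>The second summand is the difference quotient of \<open>zreg\<close> at 1, completed
  there by the derivative, so the singularity at 1 is removable.\<close>

lemma holomorphic_dsum: "dsum holomorphic_on zdom"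
proof -
  have z: "zreg holomorphic_on zdom"
    using holomorphic_zreg by (rule holomorphic_on_subset) (auto simp: zdom_def)
  show ?thesis
    unfolding dsum_def
    by (intro holomorphic_intros pole_lemma_open holomorphic_deriv z open_zdom) (auto simp: zdom_def)
qed

section \<open>Averages against the Fejer kernel\<close>

text \<open>The Fourier transform of the triangle function \<open>1 - \<bar>t\<bar> / l\<close> on
  [-l, l], with the continuous value at 0: a nonnegative bump of height l and width of order
  1/l.\<close>

definition fejer :: "real \<Rightarrow> real \<Rightarrow> real" where
  "fejer l u = (if u = 0 then l else 2 * (1 - cos (l * u)) / (l * u\<^sup>2))"

lemma fejer_integral:
  assumes "l > 0"
  shows "((\<lambda>t. (1 - t / l) * cos (t * u)) has_integral fejer l u / 2) {0..l}"
proof (cases "u = 0")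
  case True
  have "((\<lambda>t. (1 - t / l)) has_integral ((l - l\<^sup>2 / (2 * l)) - (0 - 0\<^sup>2 / (2 * l)))) {0..l}"
    by (rule fundamental_theorem_of_calculus)
       (use assms in \<open>auto intro!: derivative_eq_intros simp: field_simps simp flip: has_real_derivative_iff_has_vector_derivative\<close>)
  then show ?thesis using True assms by (simp add: fejer_def power2_eq_square)
next
  case False
  define F where "F = (\<lambda>t. (1 - t / l) * sin (t * u) / u - cos (t * u) / (l * u\<^sup>2))"
  have "((\<lambda>t. (1 - t / l) * cos (t * u)) has_integral (F l - F 0)) {0..l}"
  proof (rule fundamental_theorem_of_calculus)
    fix t assume "t \<in> {0..l}"
    have "(F has_real_derivative (1 - t / l) * cos (t * u)) (at t within {0..l})"
      unfolding F_def
      by (rule derivative_eq_intros refl | use assms False in \<open>simp add: field_simps power2_eq_square\<close>)+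
    then show "(F has_vector_derivative (1 - t / l) * cos (t * u)) (at t within {0..l})"
      by (simp add: has_real_derivative_iff_has_vector_derivative)
  qed (use assms in auto)
  moreover have "F l - F 0 = fejer l u / 2"
    using False assms by (simp add: F_def fejer_def diff_divide_distrib)
  ultimately show ?thesis by simp
qed

lemma fejer_nonneg: "l > 0 \<Longrightarrow> fejer l u \<ge> 0"
  by (auto simp: fejer_def)

lemma one_minus_cos: "1 - cos y = 2 * (sin (y / 2))\<^sup>2" for y :: real
  using cos_double_sin[of "y / 2"] by simp

lemma fejer_le:
  assumes "l > 0"
  shows "fejer l u \<le> l"
proof (cases "u = 0")
  case False
  have "\<bar>sin (l * u / 2)\<bar> \<le> \<bar>l * u / 2\<bar>" by (rule abs_sin_x_le_abs_x)
  then have "(sin (l * u / 2))\<^sup>2 \<le> (l * u / 2)\<^sup>2" by (simp only: abs_le_square_iff)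
  then have "2 * (1 - cos (l * u)) \<le> l * (l * u\<^sup>2)"
    unfolding one_minus_cos by (simp add: power2_eq_square field_simps)
  then show ?thesis using False assms by (simp add: fejer_def pos_divide_le_eq mult.commute)
qed (simp add: fejer_def)

lemma fejer_le2:
  assumes "l > 0" "u \<noteq> 0"
  shows "fejer l u \<le> 4 / (l * u\<^sup>2)"
proof -
  have "2 * (1 - c) \<le> 4" if "- 1 \<le> c" for c :: real using that by simp
  from this[OF cos_ge_minus_one] have "2 * (1 - cos (l * u)) \<le> 4" .
  then show ?thesis using assms by (simp only: fejer_def if_False) (intro divide_right_mono, auto)
qed

text \<open>With z = l u / 2 the kernel is l (sin z / z)^2, and sin z \<ge> z / 2 for 0 \<le> z
  \<le> 1/2.\<close>

lemma fejer_ge: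
  assumes "l > 0" "\<bar>u\<bar> \<le> 1 / l"
  shows "fejer l u \<ge> l / 4"
proof (cases "u = 0")
  case False
  have sq: "(sin z)\<^sup>2 \<ge> z\<^sup>2 / 4" if "\<bar>z\<bar> \<le> 1 / 2" for z :: real
  proof -
    have *: "sin z \<ge> z / 2" if "0 \<le> z" "z \<le> 1 / 2" for z :: real
    proof -
      have "sin 0 - 0 / 2 \<le> sin z - z / 2"
      proof (rule DERIV_nonneg_imp_nondecreasing[OF that(1)])
        fix t assume t: "0 \<le> t" "t \<le> z"
        have "((\<lambda>z. sin z - z / 2) has_real_derivative cos t - 1 / 2) (at t)"
          by (auto intro!: derivative_eq_intros)
        moreover have "(sin (t / 2))\<^sup>2 \<le> (1 / 4)\<^sup>2"
        proof (rule power_mono)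
          show "sin (t / 2) \<le> 1 / 4" using sin_x_le_x[of "t / 2"] t that by simp
          show "0 \<le> sin (t / 2)" using t that pi_gt3 by (intro sin_ge_zero) auto
        qed
        then have "cos t \<ge> 1 / 2" using one_minus_cos[of t] by (simp add: power2_eq_square)
        ultimately show "\<exists>y. ((\<lambda>z. sin z - z / 2) has_real_derivative y) (at t) \<and> 0 \<le> y"
          by (intro exI[of _ "cos t - 1 / 2"]) simp
      qed
      then show ?thesis by simp
    qed
    have "\<bar>z\<bar> / 2 \<le> \<bar>sin z\<bar>"
      using *[of z] *[of "- z"] that by (cases "z \<ge> 0") auto
    then have "(\<bar>z\<bar> / 2)\<^sup>2 \<le> \<bar>sin z\<bar>\<^sup>2" by (intro power_mono) auto
    then show ?thesis by (simp add: power_divide)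
  qed
  have "\<bar>l * u / 2\<bar> \<le> 1 / 2" using assms by (simp add: abs_mult field_simps)
  from sq[OF this] have "l * (l * u\<^sup>2) / 4 \<le> 2 * (1 - cos (l * u))"
    unfolding one_minus_cos by (simp add: power2_eq_square field_simps)
  then show ?thesis using False assms by (simp add: fejer_def pos_le_divide_eq mult.commute)
qed (use assms in \<open>simp add: fejer_def\<close>)

text \<open>A quantitative Riemann-Lebesgue lemma: integrate by parts once against
  \<open>cis (x * t) / (\<i> * x)\<close>. The two boundary terms cost 2 M and the remaining
  integral costs l M'.\<close>

lemma oscillatory_integral_bound:
  fixes \<phi> \<phi>' :: "real \<Rightarrow> complex"
  assumes l: "l > 0" and x: "x > 0"
    and der: "\<And>t. t \<in> {0..l} \<Longrightarrow> (\<phi> has_vector_derivative \<phi>' t) (at t within {0..l})"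
    and cont: "continuous_on {0..l} \<phi>'"
    and M: "\<And>t. t \<in> {0..l} \<Longrightarrow> cmod (\<phi> t) \<le> M" "\<And>t. t \<in> {0..l} \<Longrightarrow> cmod (\<phi>' t) \<le> M'"
    and J: "((\<lambda>t. \<phi> t * cis (x * t)) has_integral J) {0..l}"
  shows "cmod J \<le> (2 * M + l * M') / x"
proof -
  define F where "F = (\<lambda>t. \<phi> t * (cis (x * t) / (\<i> * of_real x)))"
  have cisd: "((\<lambda>t. cis (x * t) / (\<i> * of_real x)) has_vector_derivative cis (x * t)) (at t within {0..l})" for t
  proof -
    have "((\<lambda>z. exp (\<i> * of_real x * z) / (\<i> * of_real x)) has_field_derivative exp (\<i> * of_real x * of_real t)) (at (of_real t))"
      using x by (auto intro!: derivative_eq_intros)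
    from has_vector_derivative_real_field[OF this]
    have "((\<lambda>t. exp (\<i> * of_real x * of_real t) / (\<i> * of_real x)) has_vector_derivative exp (\<i> * of_real x * of_real t)) (at t within {0..l})" .
    then show ?thesis by (simp add: cis_conv_exp mult.assoc)
  qed
  have "((\<lambda>t. \<phi> t * cis (x * t) + \<phi>' t * (cis (x * t) / (\<i> * of_real x))) has_integral (F l - F 0)) {0..l}"
  proof (rule fundamental_theorem_of_calculus)
    fix t assume t: "t \<in> {0..l}"
    show "(F has_vector_derivative \<phi> t * cis (x * t) + \<phi>' t * (cis (x * t) / (\<i> * of_real x))) (at t within {0..l})"
      unfolding F_def by (rule has_vector_derivative_mult[OF der[OF t] cisd])
  qed (use l in auto)
  from has_integral_diff[OF this J]
  have I: "((\<lambda>t. \<phi>' t * (cis (x * t) / (\<i> * of_real x))) has_integral (F l - F 0 - J)) {0..l}" by simp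
  have "M' \<ge> 0" by (rule order_trans[OF norm_ge_zero M(2)[of 0]]) (use l in auto)
  have "cmod (F l - F 0 - J) \<le> M' / x * measure lborel (cbox 0 l)"
  proof (rule has_integral_bound)
    show "((\<lambda>t. \<phi>' t * (cis (x * t) / (\<i> * of_real x))) has_integral (F l - F 0 - J)) (cbox 0 l)"
      using I by simp
    show "cmod (\<phi>' t * (cis (x * t) / (\<i> * of_real x))) \<le> M' / x" if "t \<in> cbox 0 l" for t
      using M(2)[of t] that x by (simp add: norm_mult norm_divide divide_right_mono)
  qed (use \<open>M' \<ge> 0\<close> x in auto)
  moreover have "cmod (F l) \<le> M / x" "cmod (F 0) \<le> M / x"
    using M(1)[of l] M(1)[of 0] l x by (auto simp: F_def norm_mult norm_divide divide_right_mono)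
  moreover have "cmod J \<le> cmod (F l - F 0 - J) + (cmod (F l) + cmod (F 0))"
    using norm_triangle_ineq4[of "F l - F 0" "F l - F 0 - J"] norm_triangle_ineq4[of "F l" "F 0"] by simp
  moreover have "M' / x * measure lborel (cbox 0 l) = l * M' / x" using l by simp
  moreover have "(2 * M + l * M') / x = M / x + M / x + l * M' / x"
    by (simp add: add_divide_distrib)
  ultimately show ?thesis by linarith
qed

text \<open>The rectangle is compact and lies in \<open>zdom\<close>, its edge \<sigma> = 1
  included, thanks to the non-vanishing of \<open>zreg\<close>. This makes B uniform as \<sigma>
  approaches 1.\<close>

lemma dsum_bound:
  "\<exists>B. \<forall>\<sigma>\<in>{1..2}. \<forall>t\<in>{0..l}. cmod (dsum (of_real \<sigma> + \<i> * of_real t)) \<le> B \<and>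
      cmod (deriv dsum (of_real \<sigma> + \<i> * of_real t)) \<le> B"
proof -
  define K where "K = (\<lambda>p. complex_of_real (fst p) + \<i> * of_real (snd p)) ` ({1..2} \<times> {0..l})"
  have "compact K" unfolding K_def
    by (intro compact_continuous_image compact_Times continuous_intros) auto
  have "K \<subseteq> zdom" using zreg_nonzero by (auto simp: K_def zdom_def)
  have "continuous_on K dsum" "continuous_on K (deriv dsum)"
    by (intro continuous_on_subset[OF holomorphic_on_imp_continuous_on \<open>K \<subseteq> zdom\<close>]
      holomorphic_deriv holomorphic_dsum open_zdom)+
  then have "bounded (dsum ` K)" "bounded (deriv dsum ` K)"
    using \<open>compact K\<close> by (auto intro!: compact_imp_bounded compact_continuous_image)
  then obtain B1 B2 where B: "\<And>z. z \<in> K \<Longrightarrow> cmod (dsum z) \<le> B1" "\<And>z. z \<in> K \<Longrightarrow> cmod (deriv dsum z) \<le> B2"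
    unfolding bounded_iff by blast
  have K: "of_real \<sigma> + \<i> * of_real t \<in> K" if "\<sigma> \<in> {1..2}" "t \<in> {0..l}" for \<sigma> t
    unfolding K_def using that by (intro image_eqI[of _ _ "(\<sigma>, t)"]) auto
  show ?thesis
    by (intro exI[of _ "max B1 B2"] ballI conjI order_trans[OF B(1)[OF K] max.cobounded1]
        order_trans[OF B(2)[OF K] max.cobounded2])
qed

lemma summable_abs_coeff:
  assumes "\<sigma> > 1"
  shows "summable (\<lambda>n. \<bar>mangoldt n - 1\<bar> * real n powr (- \<sigma>))"
proof (rule summable_comparison_test')
  show "summable (\<lambda>n. mangoldt n * real n powr (- \<sigma>) + real n powr (- \<sigma>))"
    using assms by (intro summable_add summable_mangoldt_powr) (simp_all add: summable_real_powr_iff)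
  fix n :: nat
  have "\<bar>mangoldt n - 1\<bar> \<le> mangoldt n + (1::real)" using mangoldt_nonneg[of n] by linarith
  then have "\<bar>mangoldt n - 1\<bar> * real n powr (- \<sigma>) \<le> (mangoldt n + 1) * real n powr (- \<sigma>)"
    by (rule mult_right_mono) simp
  then show "norm (\<bar>mangoldt n - 1\<bar> * real n powr (- \<sigma>)) \<le> mangoldt n * real n powr (- \<sigma>) + real n powr (- \<sigma>)"
    by (simp add: algebra_simps)
qed

text \<open>For fixed \<sigma> > 1 the series of \<open>dsum\<close> converges uniformly in t, so it
  may be integrated term by term against the triangle and \<open>cis (x * t)\<close>. The
  coefficients are real, so the real part over [0, l] is half of the Fejer kernel at x - ln
  n.\<close>

lemma fejer_sums_integral:
  assumes "l > 0" "\<sigma> > 1"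
  obtains J where
    "((\<lambda>t. dsum (of_real \<sigma> + \<i> * of_real t) * of_real (1 - t / l) * cis (x * t)) has_integral J) {0..l}"
    "(\<lambda>n. (mangoldt n - 1) * real n powr (- \<sigma>) * fejer l (x - ln (real n))) sums (2 * Re J)"
proof -
  define c :: "nat \<Rightarrow> real" where "c = (\<lambda>n. mangoldt n - 1)"
  define f where "f = (\<lambda>n t. of_real (c n) * of_nat n powr (- (of_real \<sigma> + \<i> * of_real t)) * (of_real (1 - t / l) * cis (x * t)))"
  have "uniform_limit {0..l} (\<lambda>N t. \<Sum>n<N. f n t) (\<lambda>t. \<Sum>n. f n t) sequentially"
  proof (rule Weierstrass_m_test)
    show "summable (\<lambda>n. \<bar>c n\<bar> * real n powr (- \<sigma>))"
      unfolding c_def by (rule summable_abs_coeff[OF assms(2)])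
    fix n t assume t: "t \<in> {0..l}"
    then have "\<bar>1 - t / l\<bar> \<le> 1" using assms by (auto simp: abs_le_iff field_simps)
    then have "\<bar>c n\<bar> * real n powr (- \<sigma>) * \<bar>1 - t / l\<bar> \<le> \<bar>c n\<bar> * real n powr (- \<sigma>) * 1"
      by (rule mult_left_mono) simp
    moreover have "cmod (f n t) = \<bar>c n\<bar> * real n powr (- \<sigma>) * \<bar>1 - t / l\<bar>"
      unfolding f_def norm_mult norm_nat_powr norm_cis norm_of_real by simp
    ultimately show "norm (f n t) \<le> \<bar>c n\<bar> * real n powr (- \<sigma>)" by simp
  qed
  also have "(\<lambda>t. \<Sum>n. f n t) = (\<lambda>t. dsum (of_real \<sigma> + \<i> * of_real t) * of_real (1 - t / l) * cis (x * t))"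
  proof
    fix t
    have "(\<lambda>n. (mangoldt n - 1) * of_nat n powr (- (of_real \<sigma> + \<i> * of_real t)) * (of_real (1 - t / l) * cis (x * t)))
        sums (dsum (of_real \<sigma> + \<i> * of_real t) * (of_real (1 - t / l) * cis (x * t)))"
      by (rule sums_mult2[OF dsum_sums]) (use assms in simp)
    then show "(\<Sum>n. f n t) = dsum (of_real \<sigma> + \<i> * of_real t) * of_real (1 - t / l) * cis (x * t)"
      by (simp add: f_def c_def sums_iff mult.assoc)
  qed
  finally have unif: "uniform_limit {0..l} (\<lambda>N t. \<Sum>n<N. f n t) 
      (\<lambda>t. dsum (of_real \<sigma> + \<i> * of_real t) * of_real (1 - t / l) * cis (x * t)) sequentially" .
  have contf: "continuous_on {0..l} (f n)" for n
  proof (cases "n = 0")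
    case False
    then have "f n = (\<lambda>t. of_real (c n) * exp (- (of_real \<sigma> + \<i> * of_real t) * of_real (ln (real n))) * (of_real (1 - t / l) * cis (x * t)))"
      by (simp add: f_def powr_def)
    then show ?thesis unfolding divide_inverse by (auto intro!: continuous_intros simp: cis_conv_exp)
  qed (simp add: f_def)
  then have "continuous_on {0..l} (\<lambda>t. \<Sum>n<N. f n t)" for N by (intro continuous_on_sum)
  then obtain I J where
    I: "\<forall>N. ((\<lambda>t. \<Sum>n<N. f n t) has_integral I N) {0..l}"
    and J: "((\<lambda>t. dsum (of_real \<sigma> + \<i> * of_real t) * of_real (1 - t / l) * cis (x * t)) has_integral J) {0..l}"
    and lim: "I \<longlonglongrightarrow> J"
    by (rule uniform_limit_integral[OF unif _ sequentially_bot]) blast+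
  have Ref: "Re (f n t) = c n * real n powr (- \<sigma>) * ((1 - t / l) * cos (t * (x - ln (real n))))" for n t
  proof (cases "n = 0")
    case False
    then have n: "n > 0" by simp
    have "f n t = of_real (c n * real n powr (- \<sigma>) * (1 - t / l)) * (cis (- (t * ln (real n))) * cis (x * t))"
      unfolding f_def nat_powr_cis[OF n] by simp
    also have "cis (- (t * ln (real n))) * cis (x * t) = cis (t * (x - ln (real n)))"
      by (simp add: cis_mult algebra_simps)
    finally show ?thesis by simp
  qed (simp add: f_def)
  have ReI: "Re (I N) = (\<Sum>n<N. c n * real n powr (- \<sigma>) * (fejer l (x - ln (real n)) / 2))" for N
  proof -
    have "((\<lambda>t. Re (\<Sum>n<N. f n t)) has_integral Re (I N)) {0..l}"
      using has_integral_linear[OF spec[OF I] bounded_linear_Re] by (simp add: o_def)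
    moreover have "((\<lambda>t. \<Sum>n<N. c n * real n powr (- \<sigma>) * ((1 - t / l) * cos (t * (x - ln (real n))))) has_integral
        (\<Sum>n<N. c n * real n powr (- \<sigma>) * (fejer l (x - ln (real n)) / 2))) {0..l}"
      by (intro has_integral_sum has_integral_mult_right fejer_integral assms) auto
    ultimately show ?thesis by (simp add: Ref has_integral_unique)
  qed
  have "(\<lambda>N. 2 * Re (I N)) \<longlonglongrightarrow> 2 * Re J"
    using lim by (intro tendsto_intros)
  then have "(\<lambda>n. (mangoldt n - 1) * real n powr (- \<sigma>) * fejer l (x - ln (real n))) sums (2 * Re J)"
    by (simp add: sums_def ReI sum_distrib_left c_def mult_ac)
  with J show ?thesis by (rule that)
qed

text \<open>The sum is twice the real part of an oscillatory integral whose amplitude and derivative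
  are bounded uniformly in \<sigma>. That C is free of \<sigma> later allows \<sigma> to depend on
  x.\<close>

lemma fejer_sum_bound:
  assumes "l > 0"
  shows "\<exists>C\<ge>0. \<forall>\<sigma> x. 1 < \<sigma> \<longrightarrow> \<sigma> \<le> 2 \<longrightarrow> x > 0 \<longrightarrow>
    \<bar>\<Sum>n. (mangoldt n - 1) * real n powr (- \<sigma>) * fejer l (x - ln (real n))\<bar> \<le> C / x"
proof -
  obtain B where B: "\<And>\<sigma> t. \<sigma> \<in> {1..2} \<Longrightarrow> t \<in> {0..l} \<Longrightarrow> cmod (dsum (of_real \<sigma> + \<i> * of_real t)) \<le> B"
    "\<And>\<sigma> t. \<sigma> \<in> {1..2} \<Longrightarrow> t \<in> {0..l} \<Longrightarrow> cmod (deriv dsum (of_real \<sigma> + \<i> * of_real t)) \<le> B"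
    using dsum_bound[of l] by metis
  have "B \<ge> 0" by (rule order_trans[OF norm_ge_zero B(1)[of 1 0]]) (use assms in auto)
  \<comment> \<open>Product rule for the amplitude: B bounds the derivative of \<open>dsum\<close>
    times the triangle, B / l bounds \<open>dsum\<close> times the slope of the triangle.\<close>
  define M' where "M' = B + B / l"
  show ?thesis
  proof (intro exI[of _ "2 * (2 * B + l * M')"] conjI allI impI)
    show "2 * (2 * B + l * M') \<ge> 0" using \<open>B \<ge> 0\<close> assms by (simp add: M'_def)
    fix \<sigma> x :: real assume \<sigma>: "1 < \<sigma>" "\<sigma> \<le> 2" and x: "x > 0"
    obtain J where J: "((\<lambda>t. dsum (of_real \<sigma> + \<i> * of_real t) * of_real (1 - t / l) * cis (x * t)) has_integral J) {0..l}"
      "(\<lambda>n. (mangoldt n - 1) * real n powr (- \<sigma>) * fejer l (x - ln (real n))) sums (2 * Re J)"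
      by (rule fejer_sums_integral[OF assms \<sigma>(1)])
    define p where "p = (\<lambda>t. complex_of_real \<sigma> + \<i> * of_real t)"
    define \<phi>' where "\<phi>' = (\<lambda>t. dsum (p t) * of_real (- 1 / l) + \<i> * deriv dsum (p t) * of_real (1 - t / l))"
    have pz: "p t \<in> zdom" for t using \<sigma> zreg_nonzero by (simp add: p_def zdom_def)
    have "cmod J \<le> (2 * B + l * M') / x"
    proof (rule oscillatory_integral_bound[OF assms x _ _ _ _ J(1)])
      fix t assume t: "t \<in> {0..l}"
      have w: "\<bar>1 - t / l\<bar> \<le> 1" using assms t by (auto simp: abs_le_iff field_simps)
      have D: "cmod (dsum (p t)) \<le> B" "cmod (deriv dsum (p t)) \<le> B" using B t \<sigma> by (auto simp: p_def)
      have "cmod (dsum (p t)) * \<bar>1 - t / l\<bar> \<le> B * 1" using D w \<open>B \<ge> 0\<close> by (intro mult_mono) auto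
      then show "cmod (dsum (of_real \<sigma> + \<i> * of_real t) * of_real (1 - t / l)) \<le> B"
        unfolding norm_mult norm_of_real by (simp add: p_def)
      have "cmod (deriv dsum (p t)) * \<bar>1 - t / l\<bar> \<le> B * 1" using D w \<open>B \<ge> 0\<close> by (intro mult_mono) auto
      moreover have "cmod (dsum (p t)) * (1 / l) \<le> B / l" using D assms by (simp add: divide_right_mono)
      moreover have "cmod (\<phi>' t) \<le> cmod (dsum (p t)) * (1 / l) + cmod (deriv dsum (p t)) * \<bar>1 - t / l\<bar>"
        unfolding \<phi>'_def by (rule order_trans[OF norm_triangle_ineq]) (use assms in \<open>simp only: norm_mult norm_of_real, simp\<close>)
      ultimately show "cmod (\<phi>' t) \<le> M'" by (simp add: M'_def)
      have dd: "(dsum has_field_derivative deriv dsum (p t)) (at (p t))"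
        by (rule holomorphic_derivI[OF holomorphic_dsum open_zdom pz])
      have pd: "(p has_vector_derivative \<i>) (at t within {0..l})"
        unfolding p_def by (auto intro!: derivative_eq_intros)
      have "((dsum \<circ> p) has_vector_derivative (\<i> * deriv dsum (p t))) (at t within {0..l})"
        by (rule field_vector_diff_chain_within[OF pd DERIV_subset[OF dd subset_UNIV]])
      moreover have "((\<lambda>t. complex_of_real (1 - t / l)) has_vector_derivative of_real (- 1 / l)) (at t within {0..l})"
        by (auto intro!: derivative_eq_intros simp: has_vector_derivative_of_real)
      ultimately have "((\<lambda>t. (dsum \<circ> p) t * complex_of_real (1 - t / l)) has_vector_derivative \<phi>' t) (at t within {0..l})"
        unfolding \<phi>'_def by (subst add.commute) (drule (1) has_vector_derivative_mult, simp add: add.commute)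
      then show "((\<lambda>t. dsum (of_real \<sigma> + \<i> * of_real t) * of_real (1 - t / l)) has_vector_derivative \<phi>' t) (at t within {0..l})"
        by (simp add: o_def p_def)
    next
      have "continuous_on {0..l} p" unfolding p_def by (intro continuous_intros)
      moreover have "continuous_on zdom dsum" "continuous_on zdom (deriv dsum)"
        by (intro holomorphic_on_imp_continuous_on holomorphic_deriv holomorphic_dsum open_zdom)+
      ultimately have "continuous_on {0..l} (\<lambda>t. dsum (p t))" "continuous_on {0..l} (\<lambda>t. deriv dsum (p t))"
        using pz by (auto intro: continuous_on_compose2)
      then show "continuous_on {0..l} \<phi>'" unfolding \<phi>'_def using assms by (intro continuous_intros) auto
    qed
    moreover have "\<bar>2 * Re J\<bar> \<le> 2 * cmod J" using abs_Re_le_cmod[of J] by simp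
    ultimately show "\<bar>\<Sum>n. (mangoldt n - 1) * real n powr (- \<sigma>) * fejer l (x - ln (real n))\<bar> \<le> 2 * (2 * B + l * M') / x"
      unfolding sums_unique[OF J(2), symmetric] times_divide_eq_right[symmetric] by linarith
  qed
qed

section \<open>Primes in short intervals\<close>

lemma ln_le_iff_exp: "x > 0 \<Longrightarrow> ln x \<le> y \<longleftrightarrow> x \<le> exp y" for x y :: real
  using exp_le_cancel_iff[of "ln x" y] by simp

text \<open>The integral test for the Cauchy kernel in ln z, whose antiderivative is an arctangent.
  The mean value theorem gives the integrand at some z in (n-1, n), and the factor 3 pays for
  replacing z by n.\<close>

lemma cauchy_kernel_arctan:
  assumes "n \<ge> 2"
  shows "1 / (real n * (1 + (x - ln (real n))\<^sup>2)) \<le> 3 * (arctan (ln (real n) - x) - arctan (ln (real (n - 1)) - x))"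
proof -
  define g' where "g' = (\<lambda>z. 1 / (z * (1 + (ln z - x)\<^sup>2)))"
  have "\<exists>z>real (n - 1). z < real n \<and>
      arctan (ln (real n) - x) - arctan (ln (real (n - 1)) - x) = (real n - real (n - 1)) * g' z"
  proof (rule MVT2)
    fix z assume z: "real (n - 1) \<le> z"
    then have "z > 0" using assms by simp
    then show "((\<lambda>z. arctan (ln z - x)) has_real_derivative g' z) (at z)"
      by (auto intro!: derivative_eq_intros simp: g'_def field_simps)
  qed (use assms in auto)
  then obtain z where z: "real (n - 1) < z" "z < real n"
    and eq: "arctan (ln (real n) - x) - arctan (ln (real (n - 1)) - x) = g' z"
    using assms by (auto simp: of_nat_diff)
  have "z > 1" using z assms by simp
  \<comment> \<open>As n \<ge> 2, n/z is at most 2, so the argument of the kernel moves by at most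
    1; hence 1 + (u + d)^2 \<le> 3 (1 + u^2).\<close>
  define d where "d = ln (real n) - ln z"
  have "d = ln (real n / z)" using \<open>z > 1\<close> assms by (simp add: d_def ln_div)
  also have "\<dots> \<le> real n / z - 1" using \<open>z > 1\<close> assms by (intro ln_le_minus_one) auto
  also have "\<dots> \<le> 1" using \<open>z > 1\<close> z assms by (simp add: field_simps)
  finally have d: "0 \<le> d" "d \<le> 1" using \<open>z > 1\<close> z by (auto simp: d_def)
  define u where "u = x - ln (real n)"
  have "(u + d)\<^sup>2 \<le> 2 * u\<^sup>2 + 2 * d\<^sup>2" using sum_squares_bound[of u d] by (simp add: power2_sum)
  moreover have "d\<^sup>2 \<le> 1" using d by (simp add: power_le_one)
  moreover have "u\<^sup>2 \<ge> 0" by simp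
  moreover have "1 + a \<le> 3 * (1 + b)" if "a \<le> 2 * b + 2 * c" "c \<le> 1" "0 \<le> b" for a b c :: real
    using that by simp
  ultimately have "1 + (u + d)\<^sup>2 \<le> 3 * (1 + u\<^sup>2)" by blast
  also have "u + d = - (ln z - x)" by (simp add: u_def d_def)
  finally have "1 + (ln z - x)\<^sup>2 \<le> 3 * (1 + u\<^sup>2)" by (simp only: power2_minus)
  then have "z * (1 + (ln z - x)\<^sup>2) \<le> real n * (3 * (1 + u\<^sup>2))"
    using z \<open>z > 1\<close> by (intro mult_mono) auto
  then have "1 / (real n * (3 * (1 + u\<^sup>2))) \<le> g' z"
    unfolding g'_def using \<open>z > 1\<close> assms by (intro divide_left_mono) (auto intro!: mult_pos_pos add_pos_nonneg)
  then have "3 * (1 / (real n * (3 * (1 + u\<^sup>2)))) \<le> 3 * g' z" by linarith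
  moreover have "3 * (1 / (a * (3 * b))) = 1 / (a * b)" for a b :: real by simp
  ultimately show ?thesis unfolding eq u_def by (simp only:)
qed

section \<open>Comparison of the Fejer kernel with a Cauchy kernel that has no zeros\<close>

definition cker :: "real \<Rightarrow> real" where
  "cker u = 1 / (1 + u\<^sup>2)"

lemma cker_pos: "cker u > 0" and cker_le: "cker u \<le> 1"
  by (auto simp: cker_def add_pos_nonneg)

lemma summable_powr_cker:
  assumes "\<sigma> > 1"
  shows "summable (\<lambda>n. real n powr (- \<sigma>) * cker (x - ln (real n)))"
proof (rule summable_comparison_test')
  show "summable (\<lambda>n. real n powr (- \<sigma>))" using assms by (simp add: summable_real_powr_iff)
  show "norm (real n powr (- \<sigma>) * cker (x - ln (real n))) \<le> real n powr (- \<sigma>)" for n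
    using mult_left_mono[OF cker_le, of "real n powr (- \<sigma>)"] cker_pos[of "x - ln (real n)"]
    by (simp add: abs_mult)
qed

text \<open>The term n = 1 is at most 1. The others, with \<sigma> lowered to 1, telescope into a
  difference of arctangents, which is less than pi. The bound depends neither on \<sigma> nor on
  x.\<close>

lemma sum_powr_cker_le:
  assumes "\<sigma> > 1"
  shows "(\<Sum>n. real n powr (- \<sigma>) * cker (x - ln (real n))) \<le> 1 + 3 * pi"
proof (rule suminf_le_const[OF summable_powr_cker[OF assms]])
  fix N
  let ?f = "\<lambda>n. real n powr (- \<sigma>) * cker (x - ln (real n))"
  have "sum ?f {..<N} \<le> sum ?f {..<Suc (Suc N)}"
    by (intro sum_mono2) (auto intro!: mult_nonneg_nonneg less_imp_le[OF cker_pos])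
  also have "\<dots> \<le> 1 + 3 * (arctan (ln (real (Suc N)) - x) - arctan (ln (real 1) - x))"
  proof (induction N)
    case 0
    show ?case using cker_le[of x] by simp
  next
    case (Suc N)
    let ?n = "Suc (Suc N)"
    have "real ?n powr (- \<sigma>) \<le> real ?n powr (- 1)" using assms by (intro powr_mono) auto
    also have "\<dots> = 1 / real ?n" by (subst powr_minus_divide) simp
    finally have "?f ?n \<le> (1 / real ?n) * cker (x - ln (real ?n))"
      using cker_pos less_imp_le by (intro mult_right_mono) auto
    also have "\<dots> = 1 / (real ?n * (1 + (x - ln (real ?n))\<^sup>2))" by (simp add: cker_def)
    also have "\<dots> \<le> 3 * (arctan (ln (real ?n) - x) - arctan (ln (real (?n - 1)) - x))"
      by (rule cauchy_kernel_arctan) simp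
    finally have *: "?f ?n \<le> 3 * (arctan (ln (real ?n) - x) - arctan (ln (real (Suc N)) - x))" by simp
    have "sum ?f {..<Suc ?n} = sum ?f {..<?n} + ?f ?n" by (rule sum.lessThan_Suc)
    with Suc.IH * show ?case unfolding right_diff_distrib by linarith
  qed
  also have "\<dots> \<le> 1 + 3 * pi"
    using arctan_ubound[of "ln (real (Suc N)) - x"] arctan_lbound[of "ln (real 1) - x"]
    unfolding right_diff_distrib by linarith
  finally show "sum ?f {..<N} \<le> 1 + 3 * pi" .
qed

lemma fejer_1_le_cker: "fejer 1 u \<le> 5 * cker u"
proof -
  have "fejer 1 u * u\<^sup>2 \<le> 4"
    using fejer_le2[of 1 u] by (cases "u = 0") (auto simp: field_simps)
  moreover have "fejer 1 u \<le> 1" by (rule fejer_le) simp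
  ultimately have "fejer 1 u * (1 + u\<^sup>2) \<le> 5" by (simp add: distrib_left)
  then show ?thesis by (simp add: cker_def pos_le_divide_eq add_pos_nonneg)
qed

text \<open>Both v = u and v = u - 1 satisfy the hypothesis, so one Cauchy weight at u is compared
  with two shifted Fejer kernels.\<close>

lemma fejer_1_ge:
  assumes "v\<^sup>2 \<le> 2 * (1 + u\<^sup>2)"
  shows "(1 - cos v) * cker u \<le> fejer 1 v"
proof (cases "v = 0")
  case False
  have "(1 - cos v) * v\<^sup>2 \<le> (1 - cos v) * (2 * (1 + u\<^sup>2))"
    using assms by (intro mult_left_mono) auto
  from mult_right_mono[OF this less_imp_le[OF cker_pos[of u]]]
  have "(1 - cos v) * v\<^sup>2 * cker u \<le> 2 * (1 - cos v) * ((1 + u\<^sup>2) * cker u)"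
    by (simp only: mult_ac)
  also have "(1 + u\<^sup>2) * cker u = 1" using add_pos_nonneg[of 1 "u\<^sup>2"] by (simp add: cker_def)
  finally have "(1 - cos v) * cker u * v\<^sup>2 \<le> 2 * (1 - cos v)" by (simp add: mult_ac)
  then show ?thesis using False by (simp add: fejer_def pos_le_divide_eq)
qed (simp add: fejer_def)

text \<open>The zeros of the Fejer kernel are not invariant under a unit shift.\<close>

lemma cker_le_fejer: "(2 - 2 * cos (1 / 2)) * cker u \<le> fejer 1 u + fejer 1 (u - 1)"
proof -
  \<comment> \<open>The sum-to-product formula shows that the two cosines cannot both be close to
    1.\<close>
  have "cos u + cos (u - 1) = 2 * cos (u - 1 / 2) * cos (1 / 2)"
    by (simp add: cos_plus_cos field_simps)
  also have "\<dots> \<le> 2 * 1 * cos (1 / 2)"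
    using cos_gt_zero[of "1/2"] pi_gt3 by (intro mult_right_mono mult_left_mono) auto
  finally have "(2 - 2 * cos (1 / 2)) * cker u \<le> ((1 - cos u) + (1 - cos (u - 1))) * cker u"
    using cker_pos[of u] by (intro mult_right_mono) auto
  also have "\<dots> = (1 - cos u) * cker u + (1 - cos (u - 1)) * cker u" by (rule distrib_right)
  also have "\<dots> \<le> fejer 1 u + fejer 1 (u - 1)"
  proof (intro add_mono fejer_1_ge)
    have "0 \<le> (u + 1)\<^sup>2" by simp
    then show "(u - 1)\<^sup>2 \<le> 2 * (1 + u\<^sup>2)" by (simp add: power2_eq_square algebra_simps)
  qed auto
  finally show ?thesis .
qed

lemma one_minus_cos_half_pos: "2 - 2 * cos (1 / 2 :: real) > 0"
  using cos_monotone_0_pi[of 0 "1/2"] pi_gt3 by simp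

section \<open>Uniform upper bounds for the averages\<close>

definition fsum :: "real \<Rightarrow> real \<Rightarrow> real \<Rightarrow> real" where
  "fsum l \<sigma> x = (\<Sum>n. real n powr (- \<sigma>) * fejer l (x - ln (real n)))"

definition fsum_mangoldt :: "real \<Rightarrow> real \<Rightarrow> real \<Rightarrow> real" where
  "fsum_mangoldt l \<sigma> x = (\<Sum>n. mangoldt n * real n powr (- \<sigma>) * fejer l (x - ln (real n)))"

lemma summable_bounded_mult:
  fixes f g :: "nat \<Rightarrow> real"
  assumes "summable f" "\<And>n. f n \<ge> 0" "\<And>n. 0 \<le> g n" "\<And>n. g n \<le> l"
  shows "summable (\<lambda>n. f n * g n)"
proof (rule summable_comparison_test')
  show "summable (\<lambda>n. f n * l)" by (rule summable_mult2[OF assms(1)])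
  show "norm (f n * g n) \<le> f n * l" for n using assms by (auto intro!: mult_left_mono)
qed

lemma fsum_summable:
  assumes "l > 0" "\<sigma> > 1"
  shows "summable (\<lambda>n. real n powr (- \<sigma>) * fejer l (x - ln (real n)))"
    "summable (\<lambda>n. mangoldt n * real n powr (- \<sigma>) * fejer l (x - ln (real n)))"
  using assms by (auto intro!: summable_bounded_mult[where l = l] fejer_nonneg fejer_le mult_nonneg_nonneg
      mangoldt_nonneg summable_mangoldt_powr simp: summable_real_powr_iff)

lemma fsum_diff_bound:
  assumes "l > 0"
  shows "\<exists>C\<ge>0. \<forall>\<sigma> x. 1 < \<sigma> \<longrightarrow> \<sigma> \<le> 2 \<longrightarrow> x > 0 \<longrightarrow> \<bar>fsum_mangoldt l \<sigma> x - fsum l \<sigma> x\<bar> \<le> C / x"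
proof -
  have "fsum_mangoldt l \<sigma> x - fsum l \<sigma> x = (\<Sum>n. (mangoldt n - 1) * real n powr (- \<sigma>) * fejer l (x - ln (real n)))"
    if "\<sigma> > 1" for \<sigma> x
    unfolding fsum_def fsum_mangoldt_def
    by (subst suminf_diff) (use fsum_summable[OF assms that] in \<open>auto simp: algebra_simps\<close>)
  note eq = this
  obtain C where "C \<ge> 0" "\<forall>\<sigma> x. 1 < \<sigma> \<longrightarrow> \<sigma> \<le> 2 \<longrightarrow> x > 0 \<longrightarrow>
    \<bar>\<Sum>n. (mangoldt n - 1) * real n powr (- \<sigma>) * fejer l (x - ln (real n))\<bar> \<le> C / x"
    using fejer_sum_bound[OF assms] by blast
  then show ?thesis by (intro exI[of _ C]) (simp add: eq)
qed

lemma fsum_1_le: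
  assumes "\<sigma> > 1"
  shows "fsum 1 \<sigma> x \<le> 5 * (1 + 3 * pi)"
proof -
  have "fsum 1 \<sigma> x \<le> (\<Sum>n. 5 * (real n powr (- \<sigma>) * cker (x - ln (real n))))"
    unfolding fsum_def
  proof (rule suminf_le)
    fix n
    show "real n powr (- \<sigma>) * fejer 1 (x - ln (real n)) \<le> 5 * (real n powr (- \<sigma>) * cker (x - ln (real n)))"
      using mult_left_mono[OF fejer_1_le_cker[of "x - ln (real n)"], of "real n powr (- \<sigma>)"] by (simp add: mult_ac)
  qed (intro fsum_summable summable_mult summable_powr_cker assms zero_less_one)+
  also have "\<dots> = 5 * (\<Sum>n. real n powr (- \<sigma>) * cker (x - ln (real n)))"
    by (rule suminf_mult[OF summable_powr_cker[OF assms]])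
  also have "\<dots> \<le> 5 * (1 + 3 * pi)" using sum_powr_cker_le[OF assms, of x] by simp
  finally show ?thesis .
qed

lemma summable_mangoldt_cker:
  "\<sigma> > 1 \<Longrightarrow> summable (\<lambda>n. mangoldt n * real n powr (- \<sigma>) * cker (x - ln (real n)))"
  by (intro summable_bounded_mult[where l = 1] cker_le mult_nonneg_nonneg mangoldt_nonneg
      summable_mangoldt_powr less_imp_le[OF cker_pos]) simp_all

text \<open>The Fejer averages of \<Lambda> with l = 1 are bounded, being close to those of the
  constant 1, and two of them, centred at x and x - 1, dominate the Cauchy average. This a priori
  bound later controls the tails of every narrower Fejer kernel; x \<ge> 2 keeps both centres at
  least 1.\<close>

lemma sum_mangoldt_cker_bound:
  "\<exists>M>0. \<forall>\<sigma> x. 1 < \<sigma> \<longrightarrow> \<sigma> \<le> 2 \<longrightarrow> x \<ge> 2 \<longrightarrow>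
     (\<Sum>n. mangoldt n * real n powr (- \<sigma>) * cker (x - ln (real n))) \<le> M"
proof -
  obtain C where C: "C \<ge> 0" "\<And>\<sigma> x. 1 < \<sigma> \<Longrightarrow> \<sigma> \<le> 2 \<Longrightarrow> x > 0 \<Longrightarrow> \<bar>fsum_mangoldt 1 \<sigma> x - fsum 1 \<sigma> x\<bar> \<le> C / x"
    using fsum_diff_bound[of 1] by auto
  define k where "k = 2 - 2 * cos (1 / 2 :: real)"
  have "k > 0" unfolding k_def by (rule one_minus_cos_half_pos)
  define M where "M = (2 * (5 * (1 + 3 * pi) + C) + 1) / k"
  have "(\<Sum>n. mangoldt n * real n powr (- \<sigma>) * cker (x - ln (real n))) \<le> M"
    if \<sigma>: "1 < \<sigma>" "\<sigma> \<le> 2" and x: "x \<ge> 2" for \<sigma> x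
  proof -
    have *: "fsum_mangoldt 1 \<sigma> y \<le> 5 * (1 + 3 * pi) + C" if "y \<ge> 1" for y
    proof -
      have "C / y \<le> C / 1" using that C(1) by (intro divide_left_mono) auto
      then show ?thesis using C(2)[of \<sigma> y] fsum_1_le[of \<sigma> y] \<sigma> that by linarith
    qed
    let ?f = "\<lambda>n. mangoldt n * real n powr (- \<sigma>)"
    have "k * (\<Sum>n. ?f n * cker (x - ln (real n))) = (\<Sum>n. k * (?f n * cker (x - ln (real n))))"
      by (rule suminf_mult[OF summable_mangoldt_cker[OF \<sigma>(1)], symmetric])
    also have "\<dots> \<le> (\<Sum>n. ?f n * fejer 1 (x - ln (real n)) + ?f n * fejer 1 (x - 1 - ln (real n)))"
    proof (rule suminf_le)
      fix n
      have "?f n * (k * cker (x - ln (real n))) \<le> ?f n * (fejer 1 (x - ln (real n)) + fejer 1 (x - ln (real n) - 1))"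
        using cker_le_fejer[of "x - ln (real n)"] mangoldt_nonneg[of n] unfolding k_def by (intro mult_left_mono) auto
      then show "k * (?f n * cker (x - ln (real n))) \<le> ?f n * fejer 1 (x - ln (real n)) + ?f n * fejer 1 (x - 1 - ln (real n))"
        by (simp add: algebra_simps)
    qed (intro fsum_summable summable_add summable_mult summable_mangoldt_cker \<sigma> zero_less_one)+
    also have "\<dots> = fsum_mangoldt 1 \<sigma> x + fsum_mangoldt 1 \<sigma> (x - 1)"
      unfolding fsum_mangoldt_def by (rule suminf_add[symmetric]) (intro fsum_summable \<sigma> zero_less_one)+
    also have "\<dots> \<le> k * M" using *[of x] *[of "x - 1"] x \<open>k > 0\<close> by (simp add: M_def)
    finally show ?thesis using \<open>k > 0\<close> by simp
  qed
  moreover have "M > 0" using \<open>k > 0\<close> C(1) pi_gt_zero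
    unfolding M_def by (intro divide_pos_pos add_nonneg_pos) auto
  ultimately show ?thesis by blast
qed

section \<open>Lower bounds in a window and the passage to primes\<close>

lemma card_nat_interval_ge:
  fixes a b :: real
  assumes "0 \<le> a"
  shows "finite {n. a \<le> real n \<and> real n \<le> b}" "real (card {n. a \<le> real n \<and> real n \<le> b}) \<ge> b - a - 1"
proof -
  have eq: "{n. a \<le> real n \<and> real n \<le> b} = {nat \<lceil>a\<rceil>..<nat (\<lfloor>b\<rfloor> + 1)}"
    by (auto simp: le_nat_iff nat_less_iff zless_nat_eq_int_zless) linarith+
  then show "finite {n. a \<le> real n \<and> real n \<le> b}" by simp
  have "real (card {n. a \<le> real n \<and> real n \<le> b}) = real (nat (\<lfloor>b\<rfloor> + 1) - nat \<lceil>a\<rceil>)"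
    unfolding eq by simp
  also have "\<dots> \<ge> real (nat (\<lfloor>b\<rfloor> + 1)) - real (nat \<lceil>a\<rceil>)" by linarith
  finally show "real (card {n. a \<le> real n \<and> real n \<le> b}) \<ge> b - a - 1"
    using assms by linarith
qed

text \<open>Only the integers between exp x and exp (x + 1/l) are kept. There are at least exp x / l
  - 1 of them, each contributing at least exp (-x - 3) l / 4, so l cancels. The second condition on
  x makes the loss of 1 in the count harmless.\<close>

lemma fsum_lower:
  assumes l: "l \<ge> 1" and x: "x \<ge> 1" "l * exp (- x) \<le> 1 / 2"
  shows "fsum l (1 + 1 / x) x \<ge> exp (- 3) / 8"
proof -
  define \<sigma> where "\<sigma> = 1 + 1 / x"
  define V where "V = {n. exp x \<le> real n \<and> real n \<le> exp (x + 1 / l)}"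
  have V: "finite V" "real (card V) \<ge> exp (x + 1 / l) - exp x - 1"
    unfolding V_def by (intro card_nat_interval_ge; simp)+
  have low: "exp (- x - 3) * (l / 4) \<le> real n powr (- \<sigma>) * fejer l (x - ln (real n))" if "n \<in> V" for n
  proof -
    have n: "exp x \<le> real n" "real n \<le> exp (x + 1 / l)" using that by (auto simp: V_def)
    then have "real n > 0" using exp_gt_zero[of x] by linarith
    then have ln: "x \<le> ln (real n)" "ln (real n) \<le> x + 1 / l"
      using n by (simp_all add: ln_ge_iff ln_le_iff_exp)
    have "1 / l \<le> 1" "1 / x \<le> 1" using l x by simp_all
    then have "(1 / x) * (1 / l) \<le> 1 * 1" using l x by (intro mult_mono) auto
    \<comment> \<open>This is where \<sigma> = 1 + 1/x pays off: compared with exponent 1, the power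
      loses only a constant factor.\<close>
    have "\<sigma> * ln (real n) \<le> \<sigma> * (x + 1 / l)"
      using ln x by (intro mult_left_mono) (auto simp: \<sigma>_def)
    also have "\<dots> = x + 1 + 1 / l + (1 / x) * (1 / l)"
      using x l by (simp add: \<sigma>_def field_simps)
    also have "\<dots> \<le> x + 3" using \<open>1 / l \<le> 1\<close> \<open>(1 / x) * (1 / l) \<le> 1 * 1\<close> by linarith
    finally have "exp (- x - 3) \<le> real n powr (- \<sigma>)"
      using \<open>real n > 0\<close> by (simp add: powr_def)
    moreover have "fejer l (x - ln (real n)) \<ge> l / 4" using ln l by (intro fejer_ge) auto
    ultimately show ?thesis using l by (intro mult_mono) auto
  qed
  have "1 / l \<le> exp (1 / l) - 1" using exp_ge_add_one_self[of "1 / l"] by linarith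
  then have "exp x * (1 / l) \<le> exp x * (exp (1 / l) - 1)" by (rule mult_left_mono) simp
  then have "real (card V) \<ge> exp x / l - 1" using V(2) by (simp add: exp_add algebra_simps)
  then have "(exp x / l - 1) * (exp (- x - 3) * (l / 4)) \<le> real (card V) * (exp (- x - 3) * (l / 4))"
    using l by (intro mult_right_mono) auto
  also have "\<dots> \<le> (\<Sum>n\<in>V. real n powr (- \<sigma>) * fejer l (x - ln (real n)))"
    using sum_mono[OF low, of V] by simp
  also have "\<dots> \<le> fsum l \<sigma> x"
    unfolding fsum_def
    by (rule sum_le_suminf[OF fsum_summable(1) V(1)]) (use l x in \<open>auto simp: \<sigma>_def intro!: mult_nonneg_nonneg fejer_nonneg\<close>)
  finally have "(exp x / l - 1) * (exp (- x - 3) * (l / 4)) \<le> fsum l \<sigma> x" .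
  also have "(exp x / l - 1) * (exp (- x - 3) * (l / 4)) = exp (- 3) / 4 * (1 - l * exp (- x))"
    using l by (simp add: exp_diff exp_minus field_simps)
  finally have *: "exp (- 3) / 4 * (1 - l * exp (- x)) \<le> fsum l \<sigma> x" .
  have "exp (- 3) / 4 * (1 / 2) \<le> exp (- 3) / 4 * (1 - l * exp (- x))"
    using x by (intro mult_left_mono) auto
  from order_trans[OF this *] show ?thesis unfolding \<sigma>_def by simp
qed

text \<open>Start from the lower bound exp (-3) / 8 for the constant coefficients. The part outside
  the window and the error C / x of passing to \<Lambda> each cost at most exp (-3) / 32, which
  leaves exp (-3) / 16. First l is chosen to tame the tail, then x large in terms of l.\<close>

lemma mangoldt_window_lower:
  assumes "\<epsilon> > 0"
  shows "\<exists>l>0. \<forall>\<^sub>F x in at_top. exp (- 3) / 16 \<le>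
    (\<Sum>n | n > 0 \<and> \<bar>x - ln (real n)\<bar> \<le> \<epsilon>. mangoldt n * real n powr (- (1 + 1 / x)) * fejer l (x - ln (real n)))"
proof -
  obtain M where M: "M > 0" "\<And>\<sigma> x. 1 < \<sigma> \<Longrightarrow> \<sigma> \<le> 2 \<Longrightarrow> x \<ge> 2 \<Longrightarrow>
     (\<Sum>n. mangoldt n * real n powr (- \<sigma>) * cker (x - ln (real n))) \<le> M"
    using sum_mangoldt_cker_bound by metis
  \<comment> \<open>For \<bar>u\<bar> > \<epsilon> one has 1 + u^2 \<le> (1 + 1/\<epsilon>^2) u^2,
    so the Fejer tail 4 / (l u^2) is at most B / l times the Cauchy kernel.\<close>
  define B where "B = 4 * (1 + 1 / \<epsilon>\<^sup>2)"
  have "B > 0" using assms by (auto simp: B_def intro!: add_pos_nonneg)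
  define l where "l = max 1 (B * M / (exp (- 3) / 32))"
  have "l \<ge> 1" by (simp add: l_def)
  have "B * M / (exp (- 3) / 32) \<le> l" by (simp add: l_def)
  then have Bl: "B / l * M \<le> exp (- 3) / 32" using \<open>l \<ge> 1\<close> by (simp add: field_simps)
  obtain C where C: "C \<ge> 0" "\<And>\<sigma> x. 1 < \<sigma> \<Longrightarrow> \<sigma> \<le> 2 \<Longrightarrow> x > 0 \<Longrightarrow> \<bar>fsum_mangoldt l \<sigma> x - fsum l \<sigma> x\<bar> \<le> C / x"
    using fsum_diff_bound[of l] \<open>l \<ge> 1\<close> by auto
  have "((\<lambda>x. C / x) \<longlongrightarrow> 0) at_top" by real_asymp
  then have e1: "\<forall>\<^sub>F x in at_top. C / x < exp (- 3) / 32"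
    by (rule order_tendstoD) simp
  have "((\<lambda>x. l * exp (- x)) \<longlongrightarrow> 0) at_top" by real_asymp
  then have e2: "\<forall>\<^sub>F x in at_top. l * exp (- x) < 1 / 2"
    by (rule order_tendstoD) simp
  have "\<forall>\<^sub>F x in at_top. exp (- 3) / 16 \<le>
    (\<Sum>n | n > 0 \<and> \<bar>x - ln (real n)\<bar> \<le> \<epsilon>. mangoldt n * real n powr (- (1 + 1 / x)) * fejer l (x - ln (real n)))"
    using e1 e2 eventually_ge_at_top[of 2]
  proof eventually_elim
    case (elim x)
    define \<sigma> where "\<sigma> = 1 + 1 / x"
    have \<sigma>: "1 < \<sigma>" "\<sigma> \<le> 2" using elim by (auto simp: \<sigma>_def)
    define W where "W = {n. n > 0 \<and> \<bar>x - ln (real n)\<bar> \<le> \<epsilon>}"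
    have "W \<subseteq> {n. 0 \<le> real n \<and> real n \<le> exp (x + \<epsilon>)}"
      by (auto simp: W_def ln_le_iff_exp[symmetric] abs_le_iff algebra_simps)
    then have W: "finite W" using card_nat_interval_ge(1)[of 0] finite_subset by blast
    let ?f = "\<lambda>n. mangoldt n * real n powr (- \<sigma>) * fejer l (x - ln (real n))"
    let ?g = "\<lambda>n. mangoldt n * real n powr (- \<sigma>) * cker (x - ln (real n))"
    have "fsum_mangoldt l \<sigma> x \<le> (\<Sum>n. (if n \<in> W then ?f n else 0) + B / l * ?g n)"
      unfolding fsum_mangoldt_def
    proof (rule suminf_le)
      fix n
      consider "n \<in> W" | "n = 0" | "n > 0" "\<bar>x - ln (real n)\<bar> > \<epsilon>"
        by (cases "n \<in> W"; cases "n = 0") (auto simp: W_def)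
      then show "?f n \<le> (if n \<in> W then ?f n else 0) + B / l * ?g n"
      proof cases
        case 3
        define u where "u = x - ln (real n)"
        have "\<epsilon> < \<bar>u\<bar>" "u \<noteq> 0" using 3 assms by (auto simp: u_def)
        then have "\<epsilon>\<^sup>2 \<le> u\<^sup>2" using assms abs_le_square_iff[of \<epsilon> u] by auto
        then have "1 + u\<^sup>2 \<le> u\<^sup>2 / \<epsilon>\<^sup>2 + u\<^sup>2" using assms by (simp add: field_simps)
        then have "1 + u\<^sup>2 \<le> (1 + 1 / \<epsilon>\<^sup>2) * u\<^sup>2" by (simp add: algebra_simps)
        from mult_left_mono[OF this, of 4] have "4 * (1 + u\<^sup>2) \<le> B * u\<^sup>2"
          by (simp only: B_def mult.assoc)
        then have "4 \<le> B * u\<^sup>2 / (1 + u\<^sup>2)"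
          by (subst pos_le_divide_eq) (auto intro: add_pos_nonneg)
        then have "4 / u\<^sup>2 \<le> B * u\<^sup>2 / (1 + u\<^sup>2) / u\<^sup>2" by (rule divide_right_mono) simp
        then have "4 / u\<^sup>2 \<le> B * cker u" using \<open>u \<noteq> 0\<close> by (simp add: cker_def)
        then have "4 / u\<^sup>2 / l \<le> B * cker u / l" using \<open>l \<ge> 1\<close> by (intro divide_right_mono) auto
        then have "fejer l u \<le> B / l * cker u"
          using fejer_le2[of l u] \<open>u \<noteq> 0\<close> \<open>l \<ge> 1\<close> by (simp add: mult.commute)
        then have "mangoldt n * real n powr (- \<sigma>) * fejer l u \<le> mangoldt n * real n powr (- \<sigma>) * (B / l * cker u)"
          using mangoldt_nonneg[of n] by (intro mult_left_mono) auto
        moreover have "n \<notin> W" using 3 by (simp add: W_def)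
        ultimately show ?thesis by (simp add: u_def mult_ac)
      qed (use \<open>B > 0\<close> \<open>l \<ge> 1\<close> mangoldt_nonneg[of n] less_imp_le[OF cker_pos] in auto)
    next
      show "summable (\<lambda>n. (if n \<in> W then ?f n else 0) + B / l * ?g n)"
        using \<sigma> W by (intro summable_add summable_mult summable_mangoldt_cker summable_If_finite_set)
    qed (use \<sigma> \<open>l \<ge> 1\<close> in \<open>auto intro!: fsum_summable\<close>)
    also have "\<dots> = (\<Sum>n. if n \<in> W then ?f n else 0) + B / l * (\<Sum>n. ?g n)"
      by (subst suminf_mult[symmetric], rule summable_mangoldt_cker[OF \<sigma>(1)])
         (rule suminf_add[symmetric]; use \<sigma> W in \<open>intro summable_mult summable_mangoldt_cker summable_If_finite_set\<close>)
    also have "(\<Sum>n. if n \<in> W then ?f n else 0) = sum ?f W"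
      by (rule sums_unique[OF sums_If_finite_set[OF W], symmetric])
    also have "B / l * (\<Sum>n. ?g n) \<le> B / l * M"
      using M(2)[OF \<sigma>, of x] elim \<open>B > 0\<close> \<open>l \<ge> 1\<close> by (intro mult_left_mono) auto
    finally have "fsum_mangoldt l \<sigma> x \<le> sum ?f W + exp (- 3) / 32" using Bl by linarith
    moreover have "exp (- 3) / 8 \<le> fsum l \<sigma> x"
      unfolding \<sigma>_def using elim \<open>l \<ge> 1\<close> by (intro fsum_lower) auto
    moreover have "\<bar>fsum_mangoldt l \<sigma> x - fsum l \<sigma> x\<bar> \<le> C / x" using elim \<sigma> by (intro C(2)) auto
    ultimately have "exp (- 3) / 16 \<le> sum ?f W" using elim by linarith
    then show ?case by (simp only: W_def \<sigma>_def)
  qed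
  then show ?thesis using \<open>l \<ge> 1\<close> by (intro exI[of _ l]) auto
qed

text \<open>If p^k \<le> exp y with k \<ge> 2, then p^2 \<le> exp y bounds p by exp (y/2), and 2^k
  \<le> exp y with ln 2 \<ge> 1/2 bounds k by 2y.\<close>

lemma card_proper_prime_powers_le:
  assumes "y \<ge> 0"
  shows "finite {n. primepow n \<and> \<not> prime n \<and> real n \<le> exp y}"
    "real (card {n::nat. primepow n \<and> \<not> prime n \<and> real n \<le> exp y}) \<le> (exp (y / 2) + 1) * (2 * y + 1)"
proof -
  define A where "A = nat \<lfloor>exp (y / 2)\<rfloor>"
  define B where "B = nat \<lfloor>2 * y\<rfloor>"
  have sub: "{n. primepow n \<and> \<not> prime n \<and> real n \<le> exp y} \<subseteq> (\<lambda>(p, k). p ^ k) ` ({..A} \<times> {..B})"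
  proof safe
    fix n :: nat assume n: "primepow n" "\<not> prime n" "real n \<le> exp y"
    then obtain p k where pk: "prime p" "k > 0" "n = p ^ k"
      by (auto simp: primepow_def)
    with n have "k \<ge> 2" by (cases "k = 1") auto
    have "p \<ge> 2" using pk prime_ge_2_nat by blast
    have "real p ^ 2 \<le> real p ^ k" using \<open>k \<ge> 2\<close> \<open>p \<ge> 2\<close> by (intro power_increasing) auto
    also have "\<dots> \<le> exp y" using n pk by simp
    also have "\<dots> = exp (y / 2) ^ 2" by (simp flip: exp_of_nat_mult)
    finally have "real p \<le> exp (y / 2)" by (rule power2_le_imp_le) simp
    then have "p \<le> A" by (simp add: A_def le_nat_floor)
    have "(2::real) ^ k \<le> real p ^ k" using \<open>p \<ge> 2\<close> by (intro power_mono) auto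
    also have "\<dots> \<le> exp y" using n pk by simp
    finally have "ln ((2::real) ^ k) \<le> y" by (simp add: ln_le_iff_exp)
    then have "real k * ln 2 \<le> y" by (simp add: ln_realpow)
    moreover have "real k * (1 / 2) \<le> real k * ln 2" using ln2_ge_two_thirds by (intro mult_left_mono) auto
    ultimately have "real k \<le> 2 * y" by linarith
    then have "k \<le> B" by (simp add: B_def le_nat_floor)
    with \<open>p \<le> A\<close> pk show "n \<in> (\<lambda>(p, k). p ^ k) ` ({..A} \<times> {..B})" by force
  qed
  then show "finite {n. primepow n \<and> \<not> prime n \<and> real n \<le> exp y}" by (rule finite_subset) auto
  have "card {n. primepow n \<and> \<not> prime n \<and> real n \<le> exp y} \<le> card ((\<lambda>(p, k). p ^ k) ` ({..A} \<times> {..B}))"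
    using sub by (intro card_mono) auto
  also have "\<dots> \<le> card ({..A} \<times> {..B})" by (rule card_image_le) auto
  finally have "card {n. primepow n \<and> \<not> prime n \<and> real n \<le> exp y} \<le> (A + 1) * (B + 1)" by simp
  then have "real (card {n. primepow n \<and> \<not> prime n \<and> real n \<le> exp y}) \<le> real ((A + 1) * (B + 1))"
    by (rule of_nat_mono)
  also have "\<dots> = real (A + 1) * real (B + 1)" by (rule of_nat_mult)
  also have "\<dots> \<le> (exp (y / 2) + 1) * (2 * y + 1)"
    using assms by (intro mult_mono) (auto simp: A_def B_def)
  finally show "real (card {n. primepow n \<and> \<not> prime n \<and> real n \<le> exp y}) \<le> (exp (y / 2) + 1) * (2 * y + 1)" .
qed

text \<open>Without a prime in the window, the sum of \<open>mangoldt_window_lower\<close> would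
  consist of proper prime powers only: of order x exp (x/2) many, each of weight of order x exp
  (-x). That tends to 0 and contradicts the lower bound.\<close>

lemma eventually_prime_near:
  assumes "\<epsilon> > 0"
  shows "\<forall>\<^sub>F x in at_top. \<exists>p::nat. prime p \<and> \<bar>x - ln (real p)\<bar> \<le> \<epsilon>"
proof -
  obtain l where l: "l > 0" and ev: "\<forall>\<^sub>F x in at_top. exp (- 3) / 16 \<le>
    (\<Sum>n | n > 0 \<and> \<bar>x - ln (real n)\<bar> \<le> \<epsilon>. mangoldt n * real n powr (- (1 + 1 / x)) * fejer l (x - ln (real n)))"
    using mangoldt_window_lower[OF assms] by blast
  have "((\<lambda>x. ((exp ((x + \<epsilon>) / 2) + 1) * (2 * (x + \<epsilon>) + 1)) * ((x + \<epsilon>) * exp (\<epsilon> - x) * l)) \<longlongrightarrow> 0) at_top"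
    by real_asymp
  then have "\<forall>\<^sub>F x in at_top. ((exp ((x + \<epsilon>) / 2) + 1) * (2 * (x + \<epsilon>) + 1)) * ((x + \<epsilon>) * exp (\<epsilon> - x) * l) < exp (- 3) / 16"
    by (rule order_tendstoD) simp
  with ev show ?thesis using eventually_ge_at_top[of 1]
  proof eventually_elim
    case (elim x)
    show ?case
    proof (rule ccontr)
      assume no: "\<not> (\<exists>p::nat. prime p \<and> \<bar>x - ln (real p)\<bar> \<le> \<epsilon>)"
      define W where "W = {n. n > 0 \<and> \<bar>x - ln (real n)\<bar> \<le> \<epsilon>}"
      define P where "P = {n::nat. primepow n \<and> \<not> prime n \<and> real n \<le> exp (x + \<epsilon>)}"
      let ?f = "\<lambda>n. mangoldt n * real n powr (- (1 + 1 / x)) * fejer l (x - ln (real n))"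
      have y: "x + \<epsilon> \<ge> 0" using elim assms by simp
      note P = card_proper_prime_powers_le[OF y, folded P_def]
      have Wle: "real n \<le> exp (x + \<epsilon>)" "ln (real n) \<le> x + \<epsilon>" "1 / real n \<le> exp (\<epsilon> - x)" "n > 0" if "n \<in> W" for n
      proof -
        show n: "n > 0" using that by (simp add: W_def)
        have *: "ln (real n) \<le> x + \<epsilon>" "x - \<epsilon> \<le> ln (real n)" using that unfolding W_def by auto
        show "ln (real n) \<le> x + \<epsilon>" by fact
        show "real n \<le> exp (x + \<epsilon>)" using *(1) n by (simp add: ln_le_iff_exp)
        have "exp (x - \<epsilon>) \<le> real n" using *(2) n by (simp add: ln_ge_iff)
        then have "1 / real n \<le> 1 / exp (x - \<epsilon>)" using n by (intro divide_left_mono) auto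
        then show "1 / real n \<le> exp (\<epsilon> - x)" by (simp add: exp_diff)
      qed
      have "finite W"
        by (rule finite_subset[OF _ card_nat_interval_ge(1)[of 0 "exp (x + \<epsilon>)"]]) (use Wle in auto)
      have "sum ?f W = sum ?f (W \<inter> P)"
      proof (rule sum.mono_neutral_right)
        show "\<forall>n\<in>W - W \<inter> P. ?f n = 0"
        proof
          fix n assume n: "n \<in> W - W \<inter> P"
          then have "\<not> prime n" using no by (auto simp: W_def)
          with n Wle(1) have "\<not> primepow n" by (auto simp: P_def)
          then show "?f n = 0" by (simp add: mangoldt_def)
        qed
      qed (use \<open>finite W\<close> in auto)
      also have "\<dots> \<le> (\<Sum>n\<in>W \<inter> P. (x + \<epsilon>) * exp (\<epsilon> - x) * l)"
      proof (rule sum_mono)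
        fix n assume "n \<in> W \<inter> P"
        then have n: "n \<in> W" by simp
        have "mangoldt n \<le> x + \<epsilon>" using mangoldt_le[OF Wle(4)[OF n]] Wle(2)[OF n] by linarith
        moreover have "real n powr (- (1 + 1 / x)) \<le> exp (\<epsilon> - x)"
        proof -
          have "real n powr (- (1 + 1 / x)) \<le> real n powr (- 1)"
            using Wle(4)[OF n] elim by (intro powr_mono) auto
          also have "\<dots> = 1 / real n" using Wle(4)[OF n] by (subst powr_minus_divide) simp
          finally show ?thesis using Wle(3)[OF n] by linarith
        qed
        ultimately show "?f n \<le> (x + \<epsilon>) * exp (\<epsilon> - x) * l"
          using l y mangoldt_nonneg[of n] by (intro mult_mono fejer_le fejer_nonneg) auto
      qed
      also have "\<dots> = real (card (W \<inter> P)) * ((x + \<epsilon>) * exp (\<epsilon> - x) * l)" by simp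
      also have "\<dots> \<le> ((exp ((x + \<epsilon>) / 2) + 1) * (2 * (x + \<epsilon>) + 1)) * ((x + \<epsilon>) * exp (\<epsilon> - x) * l)"
      proof (rule mult_right_mono)
        have "card (W \<inter> P) \<le> card P" using P(1) by (intro card_mono) auto
        then show "real (card (W \<inter> P)) \<le> (exp ((x + \<epsilon>) / 2) + 1) * (2 * (x + \<epsilon>) + 1)" using P(2) by linarith
      qed (use l y in auto)
      also have "\<dots> < exp (- 3) / 16" using elim by simp
      finally show False using elim(1) by (simp add: W_def)
    qed
  qed
qed

text \<open>The window of radius (ln c) / 2 around ln y + (ln c) / 2 is exactly [y, c y] on the
  logarithmic scale.\<close>

lemma eventually_prime_between:
  assumes "c > (1::real)"
  shows "\<forall>\<^sub>F y in at_top. \<exists>p::nat. prime p \<and> y \<le> real p \<and> real p \<le> c * y"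
proof -
  define e where "e = ln c / 2"
  have "e > 0" using assms by (simp add: e_def)
  have "filterlim (\<lambda>y. ln y + e) at_top at_top" by real_asymp
  from eventually_compose_filterlim[OF eventually_prime_near[OF \<open>e > 0\<close>] this] eventually_gt_at_top[of 0]
  show ?thesis
  proof eventually_elim
    case (elim y)
    then obtain p :: nat where p: "prime p" "\<bar>ln y + e - ln (real p)\<bar> \<le> e" by blast
    have "p > 0" using p by (simp add: prime_gt_0_nat)
    have "ln y \<le> ln (real p)" "ln (real p) \<le> ln y + 2 * e" using p(2) by linarith+
    moreover have "ln y + 2 * e = ln (c * y)" using elim assms by (simp add: e_def ln_mult)
    ultimately have "y \<le> real p" "real p \<le> c * y" using elim assms \<open>p > 0\<close> by simp_all
    then show ?case using p by blast
  qed
qed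

section \<open>Families of sets with small intersections\<close>

lemma one_intersecting_family_singletons:
  "one_intersecting_family n n 1 ((\<lambda>i. {i}) ` {1..n})"
  unfolding one_intersecting_family_def by (auto simp: card_image inj_on_def)

lemma one_intersecting_family_le:
  assumes "one_intersecting_family n m k F" "m \<ge> 1"
  shows "k \<le> n"
proof -
  have "F \<noteq> {}" using assms by (auto simp: one_intersecting_family_def)
  then obtain A where "A \<subseteq> {1..n}" "card A = k"
    using assms by (auto simp: one_intersecting_family_def)
  then show ?thesis using card_mono[of "{1..n}" A] by simp
qed

text \<open>The admissible sizes are at most n, and the singletons show that 1 is admissible, so
  \<open>Max\<close> is taken over a finite nonempty set.\<close>

lemma kappa_le1_facts:
  assumes "n \<ge> 1"
  shows "\<exists>F. one_intersecting_family n n (kappa_le1 n n) F"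
    "\<And>k F. one_intersecting_family n n k F \<Longrightarrow> k \<le> kappa_le1 n n"
proof -
  let ?S = "{k. \<exists>F. one_intersecting_family n n k F}"
  have "?S \<subseteq> {..n}" using one_intersecting_family_le assms by auto
  then have fin: "finite ?S" by (rule finite_subset) simp
  moreover have "1 \<in> ?S" using one_intersecting_family_singletons by blast
  ultimately have "Max ?S \<in> ?S" by (intro Max_in) auto
  then show "\<exists>F. one_intersecting_family n n (kappa_le1 n n) F" by (simp add: kappa_le1_def)
  show "k \<le> kappa_le1 n n" if "one_intersecting_family n n k F" for k F
    unfolding kappa_le1_def by (rule Max_ge[OF fin]) (use that in blast)
qed

text \<open>Each 2-element subset of \<open>[n]\<close> lies in at most one member of the family.\<close>

lemma one_intersecting_family_pairs:
  assumes "one_intersecting_family n m k F"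
  shows "m * (k choose 2) \<le> n choose 2"
proof (cases "m = 0")
  case False
  let ?T = "\<lambda>A. {S. S \<subseteq> A \<and> card S = (2::nat)}"
  have F: "card F = m" "\<And>A. A \<in> F \<Longrightarrow> A \<subseteq> {1..n}" "\<And>A. A \<in> F \<Longrightarrow> card A = k"
    "\<And>A B. A \<in> F \<Longrightarrow> B \<in> F \<Longrightarrow> A \<noteq> B \<Longrightarrow> card (A \<inter> B) \<le> 1"
    using assms by (auto simp: one_intersecting_family_def)
  have finF: "finite F" using False F(1) by (metis card.infinite)
  have fin: "finite A" if "A \<in> F" for A using F(2)[OF that] finite_subset by blast
  have "m * (k choose 2) = (\<Sum>A\<in>F. card (?T A))"
    using F n_subsets[OF fin] by simp
  also have "\<dots> = card (\<Union>A\<in>F. ?T A)"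
  proof (rule card_UN_disjoint[symmetric, OF finF])
    show "\<forall>A\<in>F. finite (?T A)" using fin by auto
    show "\<forall>A\<in>F. \<forall>B\<in>F. A \<noteq> B \<longrightarrow> ?T A \<inter> ?T B = {}"
    proof (intro ballI impI equals0I)
      fix A B S assume *: "A \<in> F" "B \<in> F" "A \<noteq> B" "S \<in> ?T A \<inter> ?T B"
      then have "card S \<le> card (A \<inter> B)" using fin by (intro card_mono) auto
      also have "\<dots> \<le> 1" using * F(4) by blast
      finally show False using * by simp
    qed
  qed
  also have "\<dots> \<le> card (?T {1..n})" using F(2) by (intro card_mono) auto
  also have "\<dots> = n choose 2" using n_subsets[of "{1..n}" 2] by simp
  finally show ?thesis .
qed simp

lemma kappa_le1_upper:
  assumes "n \<ge> 1"
  shows "real (kappa_le1 n n) \<le> sqrt (real n - 3 / 4) + 1 / 2"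
proof -
  define k where "k = kappa_le1 n n"
  obtain F where "one_intersecting_family n n k F" using kappa_le1_facts(1)[OF assms] by (auto simp: k_def)
  then have "n * (k choose 2) \<le> n choose 2" by (rule one_intersecting_family_pairs)
  then have "real n * real (k choose 2) \<le> real (n choose 2)" by (simp flip: of_nat_mult)
  moreover have c2: "real (j choose 2) = real j * (real j - 1) / 2" for j
    by (simp add: binomial_gbinomial gbinomial_prod_rev numeral_2_eq_2 algebra_simps)
  ultimately have "real n * (real k * (real k - 1)) \<le> real n * (real n - 1)" by simp
  then have "real k * (real k - 1) \<le> real n - 1" using assms by simp
  \<comment> \<open>Completing the square in k (k - 1) \<le> n - 1 produces the constants 1/2 and
    3/4.\<close>
  then have "(real k - 1 / 2)\<^sup>2 \<le> real n - 3 / 4" by (simp add: power2_eq_square algebra_simps)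
  then have "real k - 1 / 2 \<le> sqrt (real n - 3 / 4)" by (rule real_le_rsqrt)
  then show ?thesis by (simp add: k_def)
qed

text \<open>The graph of the affine map \<open>i \<mapsto> a i + b\<close> over \<open>\<int>/q\<close>, restricted to \<open>i < k\<close>, where the point
  \<open>(i, y)\<close> of the grid is encoded as \<open>i q + y + 1\<close>.\<close>

definition affine_line :: "nat \<Rightarrow> nat \<Rightarrow> nat \<Rightarrow> nat \<Rightarrow> nat set" where
  "affine_line q k a b = (\<lambda>i. i * q + (a * i + b) mod q + 1) ` {..<k}"

lemma affine_point_eq_iff:
  fixes q :: nat
  assumes "y < q" "z < q"
  shows "i * q + y + 1 = j * q + z + 1 \<longleftrightarrow> i = j \<and> y = z"
proof
  assume *: "i * q + y + 1 = j * q + z + 1"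
  then have "(i * q + y) div q = (j * q + z) div q" "(i * q + y) mod q = (j * q + z) mod q" by simp_all
  then show "i = j \<and> y = z" using assms by simp
qed simp

lemma card_affine_line: "q > 0 \<Longrightarrow> card (affine_line q k a b) = k"
  unfolding affine_line_def by (subst card_image) (auto simp: inj_on_def affine_point_eq_iff[simplified])

lemma affine_line_subset:
  assumes "q > 0"
  shows "affine_line q k a b \<subseteq> {1..k * q}"
proof -
  have "i * q + (a * i + b) mod q + 1 \<le> k * q" if "i < k" for i
  proof -
    have "i * q + (a * i + b) mod q + 1 \<le> (i + 1) * q"
      using mod_less_divisor[OF assms, of "a * i + b"] by simp
    also have "\<dots> \<le> k * q" using that by (intro mult_right_mono) auto
    finally show ?thesis .
  qed
  then show ?thesis by (auto simp: affine_line_def)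
qed

text \<open>A common point determines its column. Two common columns i and j give q | (a - a') (i -
  j); as k \<le> q forces \<bar>i - j\<bar> < q, primality yields a = a', and then b = b'.\<close>

lemma affine_line_Int:
  assumes q: "prime q" and k: "k \<le> q" and ab: "a < q" "b < q" "a' < q" "b' < q" "(a, b) \<noteq> (a', b')"
  shows "card (affine_line q k a b \<inter> affine_line q k a' b') \<le> 1"
proof -
  have "q > 0" using q by (rule prime_gt_0_nat)
  have uniq: "i = j" if i: "i < k" "(a * i + b) mod q = (a' * i + b') mod q"
    and j: "j < k" "(a * j + b) mod q = (a' * j + b') mod q" for i j
  proof (rule ccontr)
    assume "i \<noteq> j"
    have dv: "int q dvd (int a - int a') * int i + (int b - int b')"
      if "(a * i + b) mod q = (a' * i + b') mod q" for i
    proof -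
      have "int (a * i + b) mod int q = int (a' * i + b') mod int q" using that by (metis zmod_int)
      then have "int q dvd int (a * i + b) - int (a' * i + b')" by (simp add: mod_eq_dvd_iff)
      then show ?thesis by (simp add: algebra_simps)
    qed
    have small: "x = 0" if "int q dvd x" "\<bar>x\<bar> < int q" for x
      using that zdvd_not_zless[of "\<bar>x\<bar>" "int q"] by force
    from dvd_diff[OF dv[OF i(2)] dv[OF j(2)]]
    have "int q dvd (int a - int a') * (int i - int j)" by (simp add: algebra_simps)
    then have "int q dvd int a - int a' \<or> int q dvd int i - int j"
      using q by (simp add: prime_dvd_mult_iff)
    moreover have "\<not> int q dvd int i - int j"
    proof -
      have "\<bar>int i - int j\<bar> < int q" using i(1) j(1) k by linarith
      then show ?thesis using small[of "int i - int j"] \<open>i \<noteq> j\<close> by auto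
    qed
    ultimately have "a = a'" using small[of "int a - int a'"] ab by auto
    with dv[OF i(2)] have "b = b'" using small[of "int b - int b'"] ab by auto
    with \<open>a = a'\<close> ab show False by simp
  qed
  show ?thesis
  proof (rule ccontr)
    assume "\<not> ?thesis"
    then obtain x y where xy: "x \<in> affine_line q k a b \<inter> affine_line q k a' b'"
      "y \<in> affine_line q k a b \<inter> affine_line q k a' b'" "x \<noteq> y"
      by (metis One_nat_def card_le_Suc0_iff_eq card.infinite not_le zero_le_one)
    have "\<exists>i<k. (a * i + b) mod q = (a' * i + b') mod q \<and> z = i * q + (a * i + b) mod q + 1"
      if z: "z \<in> affine_line q k a b \<inter> affine_line q k a' b'" for z
    proof -
      obtain i i' where "i < k" "z = i * q + (a * i + b) mod q + 1" "z = i' * q + (a' * i' + b') mod q + 1"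
        using z unfolding affine_line_def by blast
      then show ?thesis using affine_point_eq_iff[of "(a * i + b) mod q" q "(a' * i' + b') mod q" i i'] \<open>q > 0\<close>
        by auto
    qed
    from this[OF xy(1)] this[OF xy(2)] uniq xy(3) show False by metis
  qed
qed

text \<open>The hypothesis \<open>n \<le> q\<^sup>2\<close> plays two roles: it gives n div q \<le>
  q, so that lines meet in at most one point, and it provides at least n lines. When n div q \<le>
  1, singletons suffice.\<close>

lemma kappa_le1_ge_div:
  assumes "n \<ge> 1" "prime q" "n \<le> q\<^sup>2"
  shows "n div q \<le> kappa_le1 n n"
proof (cases "n div q \<le> 1")
  case True
  then show ?thesis using kappa_le1_facts(2)[OF assms(1) one_intersecting_family_singletons] by linarith
next
  case False
  define k where "k = n div q"
  have "q > 0" using assms by (simp add: prime_gt_0_nat)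
  have "k \<le> q" using div_le_mono[OF assms(3), of q] \<open>q > 0\<close> by (simp add: k_def power2_eq_square)
  have "k \<ge> 2" using False by (simp add: k_def)
  define L where "L = (\<lambda>(a, b). affine_line q k a b) ` ({..<q} \<times> {..<q})"
  \<comment> \<open>Two parameter pairs with the same line would give an intersection of k \<ge> 2
    points.\<close>
  have inj: "inj_on (\<lambda>(a, b). affine_line q k a b) ({..<q} \<times> {..<q})"
  proof (rule inj_onI, rule ccontr)
    fix x y assume xy: "x \<in> {..<q} \<times> {..<q}" "y \<in> {..<q} \<times> {..<q}"
      "(case x of (a, b) \<Rightarrow> affine_line q k a b) = (case y of (a, b) \<Rightarrow> affine_line q k a b)" "x \<noteq> y"
    obtain a b a' b' where "x = (a, b)" "y = (a', b')" by (cases x, cases y)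
    with xy have *: "a < q" "b < q" "a' < q" "b' < q" "(a, b) \<noteq> (a', b')"
      "affine_line q k a b = affine_line q k a' b'" by auto
    then have "card (affine_line q k a b \<inter> affine_line q k a' b') \<le> 1"
      using \<open>k \<le> q\<close> assms(2) by (intro affine_line_Int) auto
    then show False using * \<open>k \<ge> 2\<close> card_affine_line[OF \<open>q > 0\<close>, of k a' b'] by simp
  qed
  have "card L = q\<^sup>2" unfolding L_def by (simp add: card_image[OF inj] power2_eq_square)
  then obtain F where F: "F \<subseteq> L" "card F = n"
    using obtain_subset_with_card_n[of n L] assms(3) by metis
  have "one_intersecting_family n n k F"
    unfolding one_intersecting_family_def
  proof (intro conjI ballI impI)
    fix A assume "A \<in> F"
    then obtain a b where A: "A = affine_line q k a b" "a < q" "b < q" using F(1) by (auto simp: L_def)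
    have "k * q \<le> n" by (simp add: k_def)
    then show "A \<subseteq> {1..n}" using affine_line_subset[OF \<open>q > 0\<close>, of k a b] A(1) by auto
    show "card A = k" using card_affine_line[OF \<open>q > 0\<close>] A(1) by simp
    fix B assume "B \<in> F" "A \<noteq> B"
    then have "B \<in> L" using F(1) by blast
    then obtain a' b' where B: "B = affine_line q k a' b'" "a' < q" "b' < q" by (auto simp: L_def)
    show "card (A \<inter> B) \<le> 1"
      using A B \<open>A \<noteq> B\<close> \<open>k \<le> q\<close> assms(2) unfolding A(1) B(1) by (intro affine_line_Int) auto
  qed (rule F(2))
  then show ?thesis unfolding k_def[symmetric] by (rule kappa_le1_facts(2)[OF assms(1)])
qed

section \<open>The next prime, the lower bound and the limit\<close>

lemma next_prime_props: "prime (next_prime x)" "x \<le> real (next_prime x)"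
proof -
  obtain p where "prime p" "p > nat \<lceil>x\<rceil>" using bigger_prime by blast
  then have "prime p \<and> x \<le> real p" by linarith
  then have "prime (next_prime x) \<and> x \<le> real (next_prime x)"
    unfolding next_prime_def by (rule LeastI)
  then show "prime (next_prime x)" "x \<le> real (next_prime x)" by auto
qed

lemma next_prime_le: "prime p \<Longrightarrow> x \<le> real p \<Longrightarrow> next_prime x \<le> p"
  unfolding next_prime_def by (rule Least_le) simp

lemma kappa_le1_lower:
  assumes "n \<ge> 1"
  shows "\<lfloor>real n / real (next_prime (sqrt (real n)))\<rfloor> \<le> int (kappa_le1 n n)"
proof -
  define q where "q = next_prime (sqrt (real n))"
  have q: "prime q" "sqrt (real n) \<le> real q" unfolding q_def by (rule next_prime_props)+
  from sqrt_le_D[OF q(2)] have "n \<le> q\<^sup>2" by (simp flip: of_nat_power)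
  from kappa_le1_ge_div[OF assms q(1) this] show ?thesis
    unfolding q_def[symmetric] floor_divide_of_nat_eq by simp
qed

lemma kappa_le1_asymptotic: "(\<lambda>n. real (kappa_le1 n n) / sqrt (real n)) \<longlonglongrightarrow> 1"
proof (rule order_tendstoI)
  fix a :: real assume "1 < a"
  have "((\<lambda>n. (sqrt (real n) + 1 / 2) / sqrt (real n)) \<longlongrightarrow> 1) sequentially" by real_asymp
  then have "\<forall>\<^sub>F n in sequentially. (sqrt (real n) + 1 / 2) / sqrt (real n) < a"
    using \<open>1 < a\<close> by (rule order_tendstoD)
  then show "\<forall>\<^sub>F n in sequentially. real (kappa_le1 n n) / sqrt (real n) < a"
    using eventually_ge_at_top[of 1]
  proof eventually_elim
    case (elim n)
    have "real (kappa_le1 n n) \<le> sqrt (real n - 3 / 4) + 1 / 2" using elim by (intro kappa_le1_upper) auto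
    also have "\<dots> \<le> sqrt (real n) + 1 / 2" by simp
    finally have "real (kappa_le1 n n) / sqrt (real n) \<le> (sqrt (real n) + 1 / 2) / sqrt (real n)"
      by (rule divide_right_mono) simp
    with elim show ?case by linarith
  qed
next
  fix a :: real assume "a < 1"
  \<comment> \<open>1 / c is the midpoint of max a 0 and 1, so it exceeds a while c > 1; the maximum
    guards against negative a.\<close>
  define c where "c = 2 / (1 + max a 0)"
  have "c > 1" "1 / c > a" using \<open>a < 1\<close> by (auto simp: c_def field_simps max_def)
  have "filterlim (\<lambda>n. sqrt (real n)) at_top sequentially" by real_asymp
  from eventually_compose_filterlim[OF eventually_prime_between[OF \<open>c > 1\<close>] this]
  have ev: "\<forall>\<^sub>F n in sequentially. \<exists>p::nat. prime p \<and> sqrt (real n) \<le> real p \<and> real p \<le> c * sqrt (real n)" .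
  have "((\<lambda>n. 1 / c - 1 / sqrt (real n)) \<longlongrightarrow> 1 / c) sequentially" by real_asymp
  then have "\<forall>\<^sub>F n in sequentially. a < 1 / c - 1 / sqrt (real n)"
    using \<open>1 / c > a\<close> by (rule order_tendstoD)
  with ev show "\<forall>\<^sub>F n in sequentially. a < real (kappa_le1 n n) / sqrt (real n)"
    using eventually_ge_at_top[of 1]
  proof eventually_elim
    case (elim n)
    define r where "r = sqrt (real n)"
    define q where "q = next_prime r"
    have "r > 0" using elim by (simp add: r_def)
    obtain p :: nat where p: "prime p" "r \<le> real p" "real p \<le> c * r" using elim by (auto simp: r_def)
    have "real q \<le> c * r" using next_prime_le[OF p(1,2)] p(3) unfolding q_def by linarith
    have "q > 0" using next_prime_props(1) unfolding q_def by (rule prime_gt_0_nat)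
    \<comment> \<open>Since q \<le> c r, the quotient n/q is at least r/c; the subtracted 1 pays for
      the floor and is negligible after division by r.\<close>
    have "r / c - 1 = r * r / (c * r) - 1" using \<open>r > 0\<close> by simp
    also have "\<dots> \<le> r * r / real q - 1"
      using \<open>real q \<le> c * r\<close> \<open>q > 0\<close> \<open>r > 0\<close> \<open>c > 1\<close> by (intro diff_right_mono divide_left_mono) auto
    also have "r * r = real n" by (simp add: r_def)
    also have "real n / real q - 1 \<le> real_of_int \<lfloor>real n / real q\<rfloor>" by linarith
    also have "\<dots> \<le> real (kappa_le1 n n)"
      using kappa_le1_lower[of n] elim unfolding q_def r_def by linarith
    finally have "(r / c - 1) / r \<le> real (kappa_le1 n n) / r" using \<open>r > 0\<close> by (intro divide_right_mono) auto
    moreover have "(r / c - 1) / r = 1 / c - 1 / r" using \<open>r > 0\<close> by (simp add: diff_divide_distrib)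
    ultimately show ?case using elim by (simp add: r_def)
  qed
qed

theorem theorem3p4:
  shows "(\<forall>n::nat. n \<ge> 1 \<longrightarrow>
            \<lfloor>real n / real (next_prime (sqrt (real n)))\<rfloor> \<le> int (kappa_le1 n n) \<and>
            real (kappa_le1 n n) \<le> sqrt (real n - 3 / 4) + 1 / 2) \<and>
         (\<lambda>n::nat. real (kappa_le1 n n) / sqrt (real n)) \<longlonglongrightarrow> 1"
  using kappa_le1_lower kappa_le1_upper kappa_le1_asymptotic by blast

end
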